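(* Let $H_m=(\mathcal M_{r+c})_{r,c=0}^{m-1}$ and $\widetilde H_m=(\widetilde{\mathcal M}_{r+c})_{r,c=0}^{m-1}$ be the ideal and empirical Hankel matrices, defined in the context, associated with $N\ge 1$ point sources with locations $p_1,\dots,p_N\in\mathbb D$ and strengths $q_1,\dots,q_N$. Denote by $\sigma_1(A)\ge\cdots\ge\sigma_m(A)\ge 0$ the singular values of an $m\times m$ matrix $A$. Assume that $m\ge N$, that the source locations are distinct ($p_i\neq p_j$ for $i\ne j$), and that the source strengths are nonzero ($q_j\neq0$ for all $j$). Suppose that the moment perturbations $e_n:=\widetilde{\mathcal M}_n-\mathcal M_n$ satisfy $$\max_{0\le n\le 2m-2}|e_n|\le\varepsilon_m$$ for a real number $\varepsilon_m$ with $$m\,\varepsilon_m<\tfrac12\,\sigma_N(H_m).$$ Let the numerical rank estimator be $$\widehat N=\#\{k\in\{1,\dots,m\}:\sigma_k(\widetilde H_m)>\tau_m\},$$ where the threshold $\tau_m$ satisfies $$m\,\varepsilon_m<\tau_m<\sigma_N(H_m)-m\,\varepsilon_m .$$ Then $$\widehat N=N .$$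
   Context: $\mathbb D=\{z\in\mathbb C:|z|<1\}$, with $\mathbb R^2$ identified with $\mathbb C$. The sources have locations $p_j\in\mathbb D$ and real strengths $q_j$, $j=1,\dots,N$, for the heat equation $$\partial_t u-\Delta u=\sum_{j=1}^N q_j\,\delta(x-p_j)\ \text{ in }\mathbb D\times(0,\infty),\qquad u=0\ \text{ on }\partial\mathbb D\times(0,\infty),\qquad u(\cdot,0)=0\ \text{ in }\mathbb D .$$ The boundary flux is $f(\theta,t)=\frac{\partial u}{\partial\nu}(e^{i\theta},t)$ with $\nu$ the outward unit normal, and $\widehat f(\theta,s)$ is its Laplace transform in $t$. For $s\ge 0$ let $G_s(x,y)$ be the Green's function of $s-\Delta$ on $\mathbb D$ with homogeneous Dirichlet boundary conditions (so $-\Delta_x G_0(x,y)=\delta(x-y)$). For $s>0$, $\widehat f(\theta,s)=\frac1s\sum_{j=1}^N q_j\frac{\partial G_s}{\partial\nu}(e^{i\theta},p_j)$ (normal derivative in the first variable), and $$g(\theta)=\lim_{s\to 0}s\,\widehat f(\theta,s)=\sum_{j=1}^N q_j\frac{\partial G_0}{\partial\nu}(e^{i\theta},p_j).$$ The ideal moments are $\mathcal M_n=\frac1{2\pi}\int_0^{2\pi} g(\theta)e^{-in\theta}\,d\theta$, $n\ge 0$. Discrete noisy data: for an integer $L\ge 1$, let $\theta_\ell=\frac{2\pi(\ell-1)}{L}$, $\ell=1,\dots,L$, and let $g_\ell^\delta=g(\theta_\ell)+\eta_\ell$, where the $\eta_\ell$ are real numbers (measurement noise). The noisy discrete moments are $$\widetilde{\mathcal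 M}_n=\frac1L\sum_{\ell=1}^L g_\ell^\delta e^{-in\theta_\ell},\qquad n=0,1,\dots,2m-2 .$$ *)

theory Defs
  imports "HOL-Analysis.Analysis" "Jordan_Normal_Form.Schur_Decomposition"
begin

text \<open>The plane is identified with \<^typ>\<open>complex\<close>; \<open>partial_x\<close> and \<open>partial_y\<close> are the
  partial derivatives along the real and imaginary axes.\<close>

definition partial_x :: "(complex \<Rightarrow> real) \<Rightarrow> complex \<Rightarrow> real" where
  "partial_x f z = deriv (\<lambda>t. f (z + of_real t)) 0"

definition partial_y :: "(complex \<Rightarrow> real) \<Rightarrow> complex \<Rightarrow> real" where
  "partial_y f z = deriv (\<lambda>t. f (z + \<i> * of_real t)) 0"

definition laplacian :: "(complex \<Rightarrow> real) \<Rightarrow> complex \<Rightarrow> real" where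
  "laplacian f z = partial_x (partial_x f) z + partial_y (partial_y f) z"

definition C1_on :: "complex set \<Rightarrow> (complex \<Rightarrow> real) \<Rightarrow> bool" where
  "C1_on S f \<longleftrightarrow>
     f differentiable_on S \<and> continuous_on S (partial_x f) \<and> continuous_on S (partial_y f)"

definition C2_on :: "complex set \<Rightarrow> (complex \<Rightarrow> real) \<Rightarrow> bool" where
  "C2_on S f \<longleftrightarrow> C1_on S f \<and> C1_on S (partial_x f) \<and> C1_on S (partial_y f)"

text \<open>\<open>dirichlet_green s G\<close>: \<open>G x y\<close> is the Green's function of \<open>s - \<Delta>\<close> on the unit disk with
  homogeneous Dirichlet data, for \<open>s \<ge> 0\<close>. The equation \<open>(s - \<Delta>) G(\<cdot>,y) = \<delta>\<^sub>y\<close> is expressed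
  classically: the homogeneous equation holds off \<open>y\<close>, and \<open>G(\<cdot>,y)\<close> differs near \<open>y\<close> by a
  bounded term from \<open>- ln \<bar>x - y\<bar> / (2\<pi>)\<close>, the fundamental solution of \<open>-\<Delta>\<close> in the plane.
  The values \<open>G y y\<close> are irrelevant.\<close>

definition dirichlet_green :: "real \<Rightarrow> (complex \<Rightarrow> complex \<Rightarrow> real) \<Rightarrow> bool" where
  "dirichlet_green s G \<longleftrightarrow> (\<forall>y\<in>ball 0 1.
     C2_on (ball 0 1 - {y}) (\<lambda>x. G x y) \<and>
     (\<forall>x\<in>ball 0 1 - {y}. s * G x y - laplacian (\<lambda>x. G x y) x = 0) \<and>
     Bfun (\<lambda>x. G x y + ln (cmod (x - y)) / (2 * pi)) (at y) \<and>
     continuous_on (cball 0 1 - {y}) (\<lambda>x. G x y) \<and>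
     (\<forall>x\<in>sphere 0 1. G x y = 0))"

text \<open>Outward normal derivative on the unit circle at \<open>exp (\<i> \<theta>)\<close>, one-sided since the
  functions concerned live on the closed disk only.\<close>

definition normal_derivative :: "(complex \<Rightarrow> real) \<Rightarrow> real \<Rightarrow> real" where
  "normal_derivative u \<theta> = vector_derivative (\<lambda>r. u (of_real r * cis \<theta>)) (at 1 within {0..1})"

text \<open>The limit as \<open>s \<rightarrow> 0\<close> of \<open>s\<close> times the Laplace-transformed boundary flux; here \<open>G\<close> stands
  for the Green's function with \<open>s = 0\<close>.\<close>

definition steady_flux ::
    "(complex \<Rightarrow> complex \<Rightarrow> real) \<Rightarrow> nat \<Rightarrow> (nat \<Rightarrow> complex) \<Rightarrow> (nat \<Rightarrow> real) \<Rightarrow> real \<Rightarrow> real" where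
  "steady_flux G N p q \<theta> = (\<Sum>j=1..N. q j * normal_derivative (\<lambda>x. G x (p j)) \<theta>)"

definition ideal_moment :: "(real \<Rightarrow> real) \<Rightarrow> nat \<Rightarrow> complex" where
  "ideal_moment g n =
     1 / (2 * pi) * integral {0..2 * pi} (\<lambda>\<theta>. g \<theta> * exp (- \<i> * of_nat n * of_real \<theta>))"

definition sample_angle :: "nat \<Rightarrow> nat \<Rightarrow> real" where
  "sample_angle L l = 2 * pi * (real l - 1) / real L"

definition noisy_moment :: "(real \<Rightarrow> real) \<Rightarrow> nat \<Rightarrow> (nat \<Rightarrow> real) \<Rightarrow> nat \<Rightarrow> complex" where
  "noisy_moment g L \<eta> n =
     1 / of_nat L * (\<Sum>l=1..L. of_real (g (sample_angle L l) + \<eta> l)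
                                * exp (- \<i> * of_nat n * of_real (sample_angle L l)))"

definition hankel :: "nat \<Rightarrow> (nat \<Rightarrow> complex) \<Rightarrow> complex mat" where
  "hankel m M = Matrix.mat m m (\<lambda>(r, c). M (r + c))"

text \<open>The square roots of the eigenvalues of \<open>A\<^sup>*A\<close>, with algebraic multiplicity, in decreasing
  order; \<open>singular_value A k\<close> is 1-based, for \<open>1 \<le> k \<le> m\<close> when \<open>A\<close> is \<open>m \<times> m\<close>. The
  eigenvalues are real and nonnegative, so \<^const>\<open>Re\<close> only converts the type.\<close>

definition singular_values :: "complex mat \<Rightarrow> real list" where
  "singular_values A = rev (sorted_list_of_multiset
     (image_mset (\<lambda>z. sqrt (Re z)) (proots (char_poly (mat_adjoint A * A)))))"

definition singular_value :: "complex mat \<Rightarrow> nat \<Rightarrow> real" where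
  "singular_value A k = singular_values A ! (k - 1)"

end

theory Submission
  imports Defs "HOL-Complex_Analysis.Complex_Analysis"
begin

text \<open>The maximum principle identifies the Green's function with
  \<open>ln (\<bar>1 - y\<^sup>* x\<bar> / \<bar>x - y\<bar>) / (2\<pi>)\<close>, so its normal derivative is \<open>- 1 / (2\<pi>)\<close> times the
  Poisson kernel and the moments are \<open>M\<^sub>n = - (\<Sum>j. q\<^sub>j (p\<^sub>j\<^sup>*)\<^sup>n) / (2\<pi>)\<close>. The Hankel matrix therefore
  vanishes on the common kernel of \<open>N\<close> linear functionals, whence \<open>\<sigma>\<^bsub>N+1\<^esub>(H) = 0\<close>. A matrix
  with entries bounded by \<open>\<epsilon>\<close> has operator norm at most \<open>m \<epsilon>\<close>, so by Weyl's inequality the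
  perturbation moves each singular value by at most \<open>m \<epsilon>\<close>, and the threshold separates
  \<open>\<sigma>\<^sub>N\<close> from \<open>\<sigma>\<^bsub>N+1\<^esub>\<close>.\<close>

section \<open>Singular values\<close>

unbundle no vec_syntax
hide_const (open) Finite_Cartesian_Product.vec Finite_Cartesian_Product.row
  Finite_Cartesian_Product.mat Determinants.det

text \<open>Singular values are defined through the roots of a characteristic polynomial, so no
  variational description is available at the start. The bridge is a unitary diagonalization of
  \<open>mat_adjoint A * A\<close> whose diagonal comes in a prescribed order. It yields one
  principle: for k < n, sigma_(k+1) is the least \<open>s\<close> such that \<open>A\<close>
  stretches by at most \<open>s\<close> on the common kernel of some \<open>k\<close> functionals.
  The functionals are the rows of a \<open>k\<close> by \<open>n\<close> matrix, and a vanishing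
  determinant replaces the count of dimensions. The vanishing of sigma_(N+1) and Weyl's inequality
  are both instances. On the analytic side the obstacle is the pole. \<open>dirichlet_green\<close>
  controls \<open>G\<close> near \<open>y\<close> only up to a bounded term, so the difference from
  the explicit formula has no prescribed value or continuity at \<open>y\<close>. The formula itself
  serves as the barrier: it tends to infinity at \<open>y\<close> and is zero on the circle, so a
  small multiple of it absorbs the bounded term without spoiling the boundary values.\<close>

lemma mat_adjoint_dim [simp]:
  "dim_row (mat_adjoint A) = dim_col A" "dim_col (mat_adjoint A) = dim_row A"
  by (simp_all add: mat_adjoint_def)

lemma mat_adjoint_carrier [simp]:
  "A \<in> carrier_mat n k \<Longrightarrow> mat_adjoint A \<in> carrier_mat k n"
  by (intro carrier_matI) auto

lemma mat_adjoint_index [simp]: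
  assumes "i < dim_col A" "j < dim_row A"
  shows "mat_adjoint A $$ (i, j) = conjugate (A $$ (j, i))"
  using assms unfolding mat_adjoint_def by (simp add: mat_of_rows_def)

lemma mat_adjoint_adjoint [simp]: "mat_adjoint (mat_adjoint A) = A"
  by (rule eq_matI) auto

lemma mat_adjoint_mult:
  fixes A :: "complex mat"
  assumes "A \<in> carrier_mat n k" "B \<in> carrier_mat k l"
  shows "mat_adjoint (A * B) = mat_adjoint B * mat_adjoint A"
  using assms by (intro eq_matI) (auto simp: scalar_prod_def mult.commute intro!: sum.cong)

lemma cscalar_prod_mult_mat_vec:
  fixes A :: "complex mat"
  assumes A: "A \<in> carrier_mat n k" and x: "x \<in> carrier_vec k" and y: "y \<in> carrier_vec n"
  shows "(A *\<^sub>v x) \<bullet>c y = x \<bullet>c (mat_adjoint A *\<^sub>v y)"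
proof -
  have "(A *\<^sub>v x) \<bullet>c y = (\<Sum>i<n. \<Sum>j<k. A $$ (i, j) * x $ j * cnj (y $ i))"
    using assms by (simp add: scalar_prod_def sum_distrib_right lessThan_atLeast0)
  also have "\<dots> = (\<Sum>j<k. \<Sum>i<n. A $$ (i, j) * x $ j * cnj (y $ i))"
    by (rule sum.swap)
  also have "\<dots> = x \<bullet>c (mat_adjoint A *\<^sub>v y)"
    using assms
    by (simp add: scalar_prod_def sum_distrib_left lessThan_atLeast0 mult.assoc mult.left_commute)
  finally show ?thesis .
qed

section \<open>Euclidean norm of complex vectors\<close>

text \<open>Going through \<open>L2_set\<close> makes the Minkowski and Cauchy-Schwarz inequalities
  directly available.\<close>

definition vnorm :: "complex vec \<Rightarrow> real" where
  "vnorm v = L2_set (\<lambda>i. cmod (v $ i)) {..<dim_vec v}"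

lemma vnorm_nonneg [simp]: "0 \<le> vnorm v"
  by (simp add: vnorm_def)

lemma vnorm_sq: "(vnorm v)\<^sup>2 = (\<Sum>i<dim_vec v. (cmod (v $ i))\<^sup>2)"
  by (simp add: vnorm_def L2_set_def sum_nonneg)

lemma cscalar_prod_self: "v \<bullet>c v = complex_of_real ((vnorm v)\<^sup>2)"
  unfolding vnorm_sq
  by (simp add: scalar_prod_def lessThan_atLeast0 complex_norm_square del: of_real_power)

lemma vnorm_eq_0_iff: "v \<in> carrier_vec n \<Longrightarrow> vnorm v = 0 \<longleftrightarrow> v = 0\<^sub>v n"
  by (auto simp: vnorm_def L2_set_eq_0_iff)

lemma vnorm_triangle:
  assumes "x \<in> carrier_vec n" "y \<in> carrier_vec n"
  shows "vnorm (x + y) \<le> vnorm x + vnorm y"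
proof -
  have "vnorm (x + y) \<le> L2_set (\<lambda>i. cmod (x $ i) + cmod (y $ i)) {..<n}"
    unfolding vnorm_def using assms
    by (auto intro!: L2_set_mono norm_triangle_ineq)
  also have "\<dots> \<le> vnorm x + vnorm y"
    unfolding vnorm_def using assms by (simp add: L2_set_triangle_ineq)
  finally show ?thesis .
qed

lemma vnorm_unitary:
  assumes U: "U \<in> carrier_mat n n" "mat_adjoint U * U = 1\<^sub>m n" and x: "x \<in> carrier_vec n"
  shows "vnorm (U *\<^sub>v x) = vnorm x"
proof -
  have "complex_of_real ((vnorm (U *\<^sub>v x))\<^sup>2) = x \<bullet>c (mat_adjoint U *\<^sub>v (U *\<^sub>v x))"
    unfolding cscalar_prod_self [symmetric]
    using U x by (intro cscalar_prod_mult_mat_vec) auto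
  also have "mat_adjoint U *\<^sub>v (U *\<^sub>v x) = x"
    using U x by (metis assoc_mult_mat_vec mat_adjoint_carrier one_mult_mat_vec)
  also have "x \<bullet>c x = complex_of_real ((vnorm x)\<^sup>2)"
    by (rule cscalar_prod_self)
  finally show ?thesis
    by (simp only: of_real_eq_iff power2_eq_iff_nonneg vnorm_nonneg)
qed

text \<open>Cauchy-Schwarz in each row costs one factor \<open>sqrt n\<close>; taking the norm of
  \<open>n\<close> equal row bounds costs the other.\<close>

lemma vnorm_mult_mat_vec_le:
  assumes E: "E \<in> carrier_mat n n" and x: "x \<in> carrier_vec n"
    and bound: "\<And>i j. i < n \<Longrightarrow> j < n \<Longrightarrow> cmod (E $$ (i, j)) \<le> c"
  shows "vnorm (E *\<^sub>v x) \<le> real n * c * vnorm x"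
proof (cases "n = 0")
  case True
  then show ?thesis using E x by (simp add: vnorm_def)
next
  case False
  then have c: "0 \<le> c"
    using bound [of 0 0] norm_ge_zero by (meson gr0I order_trans)
  have entry: "cmod ((E *\<^sub>v x) $ i) \<le> c * (sqrt n * vnorm x)" if "i < n" for i
  proof -
    have "cmod ((E *\<^sub>v x) $ i) \<le> (\<Sum>j<n. cmod (E $$ (i, j)) * cmod (x $ j))"
      using E x that
      by (auto simp: scalar_prod_def lessThan_atLeast0 norm_mult [symmetric] intro!: sum_norm_le)
    also have "\<dots> \<le> (\<Sum>j<n. c * cmod (x $ j))"
      using bound that by (intro sum_mono mult_right_mono) auto
    also have "\<dots> = c * (\<Sum>j<n. \<bar>1\<bar> * \<bar>cmod (x $ j)\<bar>)"
      by (simp add: sum_distrib_left)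
    also have "\<dots> \<le> c * (L2_set (\<lambda>j. 1) {..<n} * L2_set (\<lambda>j. cmod (x $ j)) {..<n})"
      using c by (intro mult_left_mono L2_set_mult_ineq)
    also have "\<dots> = c * (sqrt n * vnorm x)"
      using x by (simp add: vnorm_def L2_set_def)
    finally show ?thesis .
  qed
  have "vnorm (E *\<^sub>v x) \<le> L2_set (\<lambda>i. c * (sqrt n * vnorm x)) {..<n}"
    unfolding vnorm_def using E entry by (auto intro!: L2_set_mono simp: vnorm_def)
  also have "\<dots> = sqrt n * (c * (sqrt n * vnorm x))"
    using c by (simp add: L2_set_def real_sqrt_mult)
  finally show ?thesis by (simp add: algebra_simps)
qed

section \<open>Unitary diagonalization of Hermitian matrices\<close>

text \<open>Gram-Schmidt on a basis that starts with \<open>v\<close> leaves \<open>v\<close> in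
  front but yields only orthogonal vectors. Dividing each by its norm makes them orthonormal, whence
  the scalar \<open>c\<close>.\<close>

lemma unitary_extension:
  fixes v :: "complex vec"
  assumes v: "v \<in> carrier_vec (Suc n)" "v \<noteq> 0\<^sub>v (Suc n)"
  obtains W c where "W \<in> carrier_mat (Suc n) (Suc n)" "mat_adjoint W * W = 1\<^sub>m (Suc n)"
    "col W 0 = c \<cdot>\<^sub>v v"
proof -
  define ws where "ws = gram_schmidt (Suc n) (basis_completion v)"
  interpret cof_vec_space "Suc n" "TYPE(complex)" .
  note b = basis_completion [OF v]
  have ws: "corthogonal ws" "set ws \<subseteq> carrier_vec (Suc n)" "length ws = Suc n"
    using gram_schmidt_result [OF b(2,4,5) ws_def] b(6) by auto
  obtain vs where vs: "basis_completion v = v # vs"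
    using b(6,7) by (cases "basis_completion v") auto
  have "hd ws = v"
    unfolding ws_def vs using v by simp
  then have ws0: "ws ! 0 = v"
    using ws(3) by (cases ws) auto
  define W where "W = mat (Suc n) (Suc n) (\<lambda>(i, j). ws ! j $ i / complex_of_real (vnorm (ws ! j)))"
  have wsc: "ws ! i \<in> carrier_vec (Suc n)" if "i < Suc n" for i
    using ws that by (metis nth_mem subsetD)
  have orth: "(\<Sum>k<Suc n. ws ! i $ k * cnj (ws ! j $ k)) = (ws ! i) \<bullet>c (ws ! j)"
    if "i < Suc n" "j < Suc n" for i j
    using wsc [OF that(1)] wsc [OF that(2)] unfolding scalar_prod_def by (auto simp: lessThan_atLeast0)
  have unit: "mat_adjoint W * W = 1\<^sub>m (Suc n)"
  proof (rule eq_matI)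
    fix i j assume "i < dim_row (1\<^sub>m (Suc n) :: complex mat)" "j < dim_col (1\<^sub>m (Suc n) :: complex mat)"
    then have i: "i < Suc n" and j: "j < Suc n" by auto
    have "(mat_adjoint W * W) $$ (i, j) =
        (\<Sum>k<Suc n. cnj (W $$ (k, i)) * W $$ (k, j))"
      using i j by (auto simp: scalar_prod_def lessThan_atLeast0 W_def)
    also have "\<dots> = (\<Sum>k<Suc n. ws ! j $ k * cnj (ws ! i $ k)) /
        complex_of_real (vnorm (ws ! i) * vnorm (ws ! j))"
      unfolding sum_divide_distrib using i j
      by (intro sum.cong) (auto simp: W_def)
    also have "\<dots> = (ws ! j) \<bullet>c (ws ! i) / complex_of_real (vnorm (ws ! i) * vnorm (ws ! j))"
      by (simp only: orth i j)
    also have "\<dots> = (if i = j then 1 else 0)"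
    proof (cases "i = j")
      case True
      have "(ws ! i) \<bullet>c (ws ! i) \<noteq> 0"
        using corthogonalD [OF ws(1)] i ws(3) by auto
      then show ?thesis
        using True by (auto simp: cscalar_prod_self power2_eq_square)
    next
      case False
      then show ?thesis
        using corthogonalD [OF ws(1), of j i] i j ws(3) by auto
    qed
    finally show "(mat_adjoint W * W) $$ (i, j) = 1\<^sub>m (Suc n) $$ (i, j)"
      using i j by simp
  qed (auto simp: W_def)
  have "col W 0 = (1 / complex_of_real (vnorm v)) \<cdot>\<^sub>v v"
    using v ws0 by (intro eq_vecI) (auto simp: W_def)
  with unit show thesis
    by (intro that [of W]) (auto simp: W_def)
qed

lemma mat_adjoint_four_block_diag:
  fixes B D :: "complex mat"
  assumes "B \<in> carrier_mat n n" "D \<in> carrier_mat k k"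
  shows "mat_adjoint (four_block_mat B (0\<^sub>m n k) (0\<^sub>m k n) D) =
    four_block_mat (mat_adjoint B) (0\<^sub>m n k) (0\<^sub>m k n) (mat_adjoint D)"
  using assms by (intro eq_matI) auto

lemma four_block_diag_mult:
  fixes B D B' D' :: "'a :: comm_ring_1 mat"
  assumes "B \<in> carrier_mat n n" "D \<in> carrier_mat k k" "B' \<in> carrier_mat n n" "D' \<in> carrier_mat k k"
  shows "four_block_mat B (0\<^sub>m n k) (0\<^sub>m k n) D * four_block_mat B' (0\<^sub>m n k) (0\<^sub>m k n) D' =
    four_block_mat (B * B') (0\<^sub>m n k) (0\<^sub>m k n) (D * D')"
  using assms by (subst mult_four_block_mat) auto

text \<open>Deflation along the list \<open>es\<close>: conjugating by a unitary matrix whose first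
  column is an eigenvector for \<open>e\<close> clears the rest of the first column, and Hermitian
  symmetry then clears the first row. The remaining block has the characteristic polynomial of the
  tail. The list is an input because the caller must be able to choose the order of the
  diagonal.\<close>

lemma hermitian_diagonalization:
  fixes A :: "complex mat"
  assumes "A \<in> carrier_mat n n" "mat_adjoint A = A"
    and "char_poly A = (\<Prod>e\<leftarrow>es. [:- e, 1:])" "length es = n"
  shows "\<exists>U\<in>carrier_mat n n. mat_adjoint U * U = 1\<^sub>m n \<and>
    mat_adjoint U * (A * U) = mat n n (\<lambda>(i, j). if i = j then es ! i else 0)"
  using assms
proof (induction es arbitrary: n A)
  case Nil
  then show ?case
    by (intro bexI [of _ "1\<^sub>m 0"]) auto
next
  case (Cons e es)
  define k where "k = length es"
  have n: "n = Suc k"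
    using Cons.prems(4) by (simp add: k_def)
  note A = Cons.prems(1) [unfolded n]
  have "eigenvalue A e"
    unfolding eigenvalue_root_char_poly [OF A] Cons.prems(3) by simp
  then obtain v where "eigenvector A v e"
    unfolding eigenvalue_def by blast
  then have v: "v \<in> carrier_vec (Suc k)" "v \<noteq> 0\<^sub>v (Suc k)" and ev: "A *\<^sub>v v = e \<cdot>\<^sub>v v"
    using A unfolding eigenvector_def by auto
  obtain W c where W: "W \<in> carrier_mat (Suc k) (Suc k)" and WW: "mat_adjoint W * W = 1\<^sub>m (Suc k)"
    and col: "col W 0 = c \<cdot>\<^sub>v v"
    using unitary_extension [OF v] by blast
  note W' = mat_adjoint_carrier [OF W]
  have WW': "W * mat_adjoint W = 1\<^sub>m (Suc k)"
    using mat_mult_left_right_inverse [OF W' W WW] .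
  define A' where "A' = mat_adjoint W * (A * W)"
  have A': "A' \<in> carrier_mat (Suc k) (Suc k)"
    unfolding A'_def using A W W' by auto
  have herm: "mat_adjoint A' = A'"
    unfolding A'_def using A W W' Cons.prems(2)
    by (simp add: mat_adjoint_mult [of _ "Suc k" "Suc k" _ "Suc k"]
        assoc_mult_mat [of _ "Suc k" "Suc k" _ "Suc k" _ "Suc k"])
  have "A *\<^sub>v col W 0 = e \<cdot>\<^sub>v col W 0"
    using A v by (simp add: col ev mult_mat_vec smult_smult_assoc mult.commute)
  then have "col (A * W) 0 = e \<cdot>\<^sub>v col W 0"
    by (simp only: col_mult2 [OF A W zero_less_Suc])
  then have col0: "A' $$ (i, 0) = (if i = 0 then e else 0)" if "i < Suc k" for i
  proof -
    have "A' $$ (i, 0) = row (mat_adjoint W) i \<bullet> col (A * W) 0"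
      using that A W W' by (simp add: A'_def)
    also have "\<dots> = e * (row (mat_adjoint W) i \<bullet> col W 0)"
      unfolding \<open>col (A * W) 0 = e \<cdot>\<^sub>v col W 0\<close> using that W W'
      by (subst scalar_prod_smult_distrib [of _ "Suc k"]) (auto intro!: carrier_vecI)
    also have "row (mat_adjoint W) i \<bullet> col W 0 = (mat_adjoint W * W) $$ (i, 0)"
      using that W by simp
    finally show ?thesis
      using that by (simp add: WW)
  qed
  have row0: "A' $$ (0, j) = (if j = 0 then e else 0)" if "j < Suc k" for j
  proof (cases "j = 0")
    case False
    have "A' $$ (0, j) = mat_adjoint A' $$ (0, j)"
      by (simp add: herm)
    also have "\<dots> = cnj (A' $$ (j, 0))"
      using A' that by simp
    finally show ?thesis
      using False col0 [OF that] by simp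
  qed (use col0 in auto)
  define E where "E = mat 1 1 (\<lambda>_. e)"
  define A3 where "A3 = mat k k (\<lambda>(i, j). A' $$ (Suc i, Suc j))"
  have A3: "A3 \<in> carrier_mat k k" and E: "E \<in> carrier_mat 1 1"
    by (simp_all add: A3_def E_def)
  have block: "A' = four_block_mat E (0\<^sub>m 1 k) (0\<^sub>m k 1) A3"
  proof (rule eq_matI)
    fix i j
    assume "i < dim_row (four_block_mat E (0\<^sub>m 1 k) (0\<^sub>m k 1) A3)"
      "j < dim_col (four_block_mat E (0\<^sub>m 1 k) (0\<^sub>m k 1) A3)"
    then have "i < Suc k" "j < Suc k"
      by (auto simp: E_def A3_def)
    then show "A' $$ (i, j) = four_block_mat E (0\<^sub>m 1 k) (0\<^sub>m k 1) A3 $$ (i, j)"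
      using col0 [of i] row0 [of j] by (cases i; cases j) (auto simp: E_def A3_def)
  qed (use A' in \<open>auto simp: E_def A3_def\<close>)
  have "similar_mat_wit A' A (mat_adjoint W) W"
    using A' A W W' WW WW'
    by (intro similar_mat_witI [of _ _ "Suc k"])
       (auto simp: A'_def assoc_mult_mat [of _ "Suc k" "Suc k" _ "Suc k" _ "Suc k"])
  then have "char_poly A' = char_poly A"
    by (intro char_poly_similar) (auto simp: similar_mat_def)
  moreover have "char_poly A' = char_poly E * char_poly A3"
    unfolding block using A3 by (intro char_poly_four_block_zeros_col) (auto simp: E_def)
  moreover have "char_poly E = [:- e, 1:]"
    using char_poly_upper_triangular [OF E upper_triangularI] by (simp add: E_def diag_mat_def)
  ultimately have "[:- e, 1:] * char_poly A3 = [:- e, 1:] * (\<Prod>e\<leftarrow>es. [:- e, 1:])"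
    using Cons.prems(3) by (metis list.map(2) prod_list.Cons)
  then have "char_poly A3 = (\<Prod>e\<leftarrow>es. [:- e, 1:])"
    unfolding mult_cancel_left by simp
  moreover have "mat_adjoint A3 = A3"
  proof (rule eq_matI)
    fix i j assume "i < dim_row A3" "j < dim_col A3"
    then show "mat_adjoint A3 $$ (i, j) = A3 $$ (i, j)"
      using A' mat_adjoint_index [of "Suc i" A' "Suc j"] by (simp add: A3_def herm)
  qed (auto simp: A3_def)
  ultimately obtain U where U: "U \<in> carrier_mat k k" and UU: "mat_adjoint U * U = 1\<^sub>m k"
    and diag: "mat_adjoint U * (A3 * U) = mat k k (\<lambda>(i, j). if i = j then es ! i else 0)"
    using Cons.IH [OF A3] by (auto simp: k_def)
  note U' = mat_adjoint_carrier [OF U]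
  \<comment> \<open>The diagonalizing matrix of the smaller block is extended by 1, so that
    \<open>W * X\<close> keeps the eigenvector already split off.\<close>
  define X where "X = four_block_mat (1\<^sub>m 1) (0\<^sub>m 1 k) (0\<^sub>m k 1) U"
  have X: "X \<in> carrier_mat (Suc k) (Suc k)"
    using U by (auto simp: X_def)
  have X': "mat_adjoint X = four_block_mat (1\<^sub>m 1) (0\<^sub>m 1 k) (0\<^sub>m k 1) (mat_adjoint U)"
    unfolding X_def using U by (subst mat_adjoint_four_block_diag) (auto intro!: arg_cong [where f = "\<lambda>B. four_block_mat B _ _ _"] eq_matI)
  have XX: "mat_adjoint X * X = 1\<^sub>m (Suc k)"
    unfolding X' unfolding X_def using U U' UU
    by (subst four_block_diag_mult) (auto intro!: eq_matI)
  have XAX: "mat_adjoint X * (A' * X) =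
      mat (Suc k) (Suc k) (\<lambda>(i, j). if i = j then (e # es) ! i else 0)"
  proof -
    have "mat_adjoint X * (A' * X) =
        four_block_mat (1\<^sub>m 1 * (E * 1\<^sub>m 1)) (0\<^sub>m 1 k) (0\<^sub>m k 1) (mat_adjoint U * (A3 * U))"
      unfolding X' block unfolding X_def
      by (simp only: four_block_diag_mult [OF E A3 one_carrier_mat U]
          four_block_diag_mult [OF one_carrier_mat U' mult_carrier_mat [OF E one_carrier_mat]
            mult_carrier_mat [OF A3 U]])
    also have "\<dots> = mat (Suc k) (Suc k) (\<lambda>(i, j). if i = j then (e # es) ! i else 0)"
      unfolding diag by (rule eq_matI) (auto simp: E_def nth_Cons')
    finally show ?thesis .
  qed
  show ?case
  proof (intro bexI conjI)
    show WX: "W * X \<in> carrier_mat n n"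
      using W X n by auto
    have adj: "mat_adjoint (W * X) = mat_adjoint X * mat_adjoint W"
      using W X by (rule mat_adjoint_mult)
    note X'c = mat_adjoint_carrier [OF X]
    note assoc = assoc_mult_mat [of _ "Suc k" "Suc k" _ "Suc k" _ "Suc k"]
    have "mat_adjoint (W * X) * (W * X) = mat_adjoint X * ((mat_adjoint W * W) * X)"
      unfolding adj using W W' X X'c by (simp add: assoc)
    then show "mat_adjoint (W * X) * (W * X) = 1\<^sub>m n"
      using X XX n by (simp add: WW)
    have "mat_adjoint (W * X) * (A * (W * X)) = mat_adjoint X * (A' * X)"
      unfolding adj A'_def using W W' X X'c A by (simp add: assoc)
    then show "mat_adjoint (W * X) * (A * (W * X)) =
        mat n n (\<lambda>(i, j). if i = j then (e # es) ! i else 0)"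
      unfolding XAX n .
  qed
qed

lemma index_mult_mat_vec_sum:
  assumes "A \<in> carrier_mat n k" "x \<in> carrier_vec k" "i < n"
  shows "(A *\<^sub>v x) $ i = (\<Sum>j<k. A $$ (i, j) * x $ j)"
  using assms by (auto simp: scalar_prod_def lessThan_atLeast0)

lemma image_mset_left_inverse:
  assumes "\<And>x. x \<in># M \<Longrightarrow> f (g x) = x"
  shows "image_mset f (image_mset g M) = M"
  using assms by (induction M) auto

lemma prod_list_map_eq_of_mset_eq:
  fixes f :: "'a \<Rightarrow> 'b :: comm_monoid_mult"
  assumes "mset xs = mset ys"
  shows "prod_list (map f xs) = prod_list (map f ys)"
  using assms by (metis mset_map prod_mset_prod_list)

section \<open>Right singular vectors\<close>

text \<open>The diagonalization is used twice: once in an arbitrary order, to see that the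
  eigenvalues are real and nonnegative, and once in the order of the sorted singular values.\<close>

lemma singular_values_diagonalization:
  assumes A: "A \<in> carrier_mat n n"
  obtains U where "U \<in> carrier_mat n n" "mat_adjoint U * U = 1\<^sub>m n"
    "mat_adjoint U * ((mat_adjoint A * A) * U) =
       mat n n (\<lambda>(i, j). if i = j then complex_of_real ((singular_values A ! i)\<^sup>2) else 0)"
    "length (singular_values A) = n" "\<forall>s\<in>set (singular_values A). 0 \<le> s"
proof -
  define B where "B = mat_adjoint A * A"
  note A' = mat_adjoint_carrier [OF A]
  have B: "B \<in> carrier_mat n n"
    using A A' by (auto simp: B_def)
  have herm: "mat_adjoint B = B"
    unfolding B_def using mat_adjoint_mult [OF A' A] by simp
  obtain es where cp: "char_poly B = (\<Prod>e\<leftarrow>es. [:- e, 1:])" and len: "length es = n"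
    using char_poly_factorized [OF B] by blast
  have roots: "proots (char_poly B) = mset es"
  proof -
    have "proots (\<Prod>e\<leftarrow>es. [:- e, 1:]) = mset es"
    proof (induction es)
      case (Cons e es)
      have "(\<Prod>e\<leftarrow>es. [:- e, 1:]) \<noteq> 0"
        by (auto simp: prod_list_zero_iff)
      with Cons show ?case
        by (simp add: proots_mult del: mult_pCons_left)
    qed simp
    then show ?thesis by (simp add: cp)
  qed
  \<comment> \<open>Each eigenvalue is the squared norm of a column of \<open>A * U\<close>.\<close>
  have nonneg: "e = complex_of_real (Re e) \<and> 0 \<le> Re e" if e: "e \<in># mset es" for e
  proof -
    obtain U where U: "U \<in> carrier_mat n n"
      and diag: "mat_adjoint U * (B * U) = mat n n (\<lambda>(i, j). if i = j then es ! i else 0)"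
      using hermitian_diagonalization [OF B herm cp len] by blast
    note U' = mat_adjoint_carrier [OF U]
    have AU: "A * U \<in> carrier_mat n n" using A U by auto
    have "mat_adjoint (A * U) * (A * U) = mat n n (\<lambda>(i, j). if i = j then es ! i else 0)"
      using diag A A' U U' unfolding B_def mat_adjoint_mult [OF A U]
      by (simp add: assoc_mult_mat [of _ n n _ n _ n])
    moreover obtain i where i: "i < n" "e = es ! i"
      using e len by (auto simp: in_set_conv_nth)
    ultimately have "e = (mat_adjoint (A * U) * (A * U)) $$ (i, i)"
      by simp
    also have "\<dots> = col (A * U) i \<bullet>c col (A * U) i"
      using AU i(1) by (auto simp: scalar_prod_def mult.commute intro!: sum.cong)
    also have "\<dots> = complex_of_real ((vnorm (col (A * U) i))\<^sup>2)"
      by (rule cscalar_prod_self)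
    finally show ?thesis by simp
  qed
  define s where "s = singular_values A"
  have ms: "mset s = image_mset (\<lambda>z. sqrt (Re z)) (mset es)"
    by (simp add: s_def singular_values_def B_def [symmetric] roots)
  then have len_s: "length s = n"
    using len by (metis size_image_mset size_mset)
  \<comment> \<open>Squaring undoes \<open>sqrt (Re z)\<close> on nonnegative reals, so the squares
    of the sorted list are again the whole spectrum and factor the same polynomial.\<close>
  have "image_mset (\<lambda>r. complex_of_real (r\<^sup>2)) (mset s) = mset es"
    unfolding ms using nonneg by (intro image_mset_left_inverse) auto
  then have "mset (map (\<lambda>r. complex_of_real (r\<^sup>2)) s) = mset es"
    by simp
  then have "char_poly B = (\<Prod>e\<leftarrow>map (\<lambda>r. complex_of_real (r\<^sup>2)) s. [:- e, 1:])"
    unfolding cp by (rule prod_list_map_eq_of_mset_eq [OF sym])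
  from hermitian_diagonalization [OF B herm this] len_s
  obtain U where U: "U \<in> carrier_mat n n" "mat_adjoint U * U = 1\<^sub>m n"
    and diag: "mat_adjoint U * (B * U) =
      mat n n (\<lambda>(i, j). if i = j then map (\<lambda>r. complex_of_real (r\<^sup>2)) s ! i else 0)"
    by auto
  show thesis
  proof (rule that [OF U])
    show "mat_adjoint U * ((mat_adjoint A * A) * U) =
      mat n n (\<lambda>(i, j). if i = j then complex_of_real ((singular_values A ! i)\<^sup>2) else 0)"
      unfolding diag [unfolded B_def] s_def [symmetric]
      by (rule eq_matI) (auto simp: len_s)
    show "length (singular_values A) = n"
      using len_s by (simp add: s_def)
    have "set s = (\<lambda>z. sqrt (Re z)) ` set es"
      using arg_cong [OF ms, of set_mset] by simp
    then show "\<forall>s\<in>set (singular_values A). 0 \<le> s"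
      using nonneg by (auto simp: s_def)
  qed
qed

text \<open>In the coordinates given by the columns of \<open>U\<close>, the right singular vectors,
  the form x -> |A x|^2 is diagonal. Everything later uses singular values only through this
  identity, their order and their sign.\<close>

lemma singular_values_basis:
  assumes A: "A \<in> carrier_mat n n"
  obtains U where "U \<in> carrier_mat n n" "mat_adjoint U * U = 1\<^sub>m n"
    "\<And>x. x \<in> carrier_vec n \<Longrightarrow>
      (vnorm (A *\<^sub>v (U *\<^sub>v x)))\<^sup>2 = (\<Sum>i<n. (singular_values A ! i)\<^sup>2 * (cmod (x $ i))\<^sup>2)"
proof -
  obtain U where U: "U \<in> carrier_mat n n" and UU: "mat_adjoint U * U = 1\<^sub>m n"
    and diag: "mat_adjoint U * ((mat_adjoint A * A) * U) =
       mat n n (\<lambda>(i, j). if i = j then complex_of_real ((singular_values A ! i)\<^sup>2) else 0)"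
      (is "_ = ?D")
    using singular_values_diagonalization [OF A] by blast
  note A' = mat_adjoint_carrier [OF A] and U' = mat_adjoint_carrier [OF U]
  show thesis
  proof (rule that [OF U UU])
    fix x :: "complex vec" assume x: "x \<in> carrier_vec n"
    have AU: "A * U \<in> carrier_mat n n" using A U by auto
    have "complex_of_real ((vnorm (A *\<^sub>v (U *\<^sub>v x)))\<^sup>2) = ((A * U) *\<^sub>v x) \<bullet>c ((A * U) *\<^sub>v x)"
      using A U x by (simp add: cscalar_prod_self del: of_real_power)
    also have "\<dots> = x \<bullet>c (mat_adjoint (A * U) *\<^sub>v ((A * U) *\<^sub>v x))"
      using AU x by (intro cscalar_prod_mult_mat_vec [OF AU]) auto
    also have "mat_adjoint (A * U) *\<^sub>v ((A * U) *\<^sub>v x) = (mat_adjoint (A * U) * (A * U)) *\<^sub>v x"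
      using AU x by (intro assoc_mult_mat_vec [OF mat_adjoint_carrier, symmetric])
    also have "mat_adjoint (A * U) * (A * U) = ?D"
      unfolding diag [symmetric] mat_adjoint_mult [OF A U] using A A' U U'
      by (simp add: assoc_mult_mat [of _ n n _ n _ n])
    also have "?D *\<^sub>v x = vec n (\<lambda>i. complex_of_real ((singular_values A ! i)\<^sup>2) * x $ i)"
    proof (rule eq_vecI)
      fix i assume "i < dim_vec (vec n (\<lambda>i. complex_of_real ((singular_values A ! i)\<^sup>2) * x $ i))"
      then have i: "i < n" by simp
      then have "(?D *\<^sub>v x) $ i =
          (\<Sum>j<n. (if i = j then complex_of_real ((singular_values A ! i)\<^sup>2) else 0) * x $ j)"
        using x by (auto simp: scalar_prod_def lessThan_atLeast0)
      also have "\<dots> = (\<Sum>j<n. if i = j then complex_of_real ((singular_values A ! i)\<^sup>2) * x $ j else 0)"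
        by (intro sum.cong) auto
      also have "\<dots> = complex_of_real ((singular_values A ! i)\<^sup>2) * x $ i"
        using i by simp
      finally show "(?D *\<^sub>v x) $ i =
          vec n (\<lambda>i. complex_of_real ((singular_values A ! i)\<^sup>2) * x $ i) $ i"
        using i by simp
    qed auto
    also have "x \<bullet>c \<dots> =
        (\<Sum>i<n. complex_of_real ((singular_values A ! i)\<^sup>2) * (x $ i * cnj (x $ i)))"
      using x by (auto simp: scalar_prod_def lessThan_atLeast0 intro!: sum.cong)
    also have "\<dots> = complex_of_real (\<Sum>i<n. (singular_values A ! i)\<^sup>2 * (cmod (x $ i))\<^sup>2)"
      by (simp only: of_real_sum of_real_mult complex_norm_square)
    finally show "(vnorm (A *\<^sub>v (U *\<^sub>v x)))\<^sup>2 =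
        (\<Sum>i<n. (singular_values A ! i)\<^sup>2 * (cmod (x $ i))\<^sup>2)"
      by (simp only: of_real_eq_iff)
  qed
qed

lemma length_singular_values: "A \<in> carrier_mat n n \<Longrightarrow> length (singular_values A) = n"
  using singular_values_diagonalization by metis

lemma singular_values_antimono:
  assumes "i \<le> j" "j < length (singular_values A)"
  shows "singular_values A ! j \<le> singular_values A ! i"
proof -
  have "sorted (rev (singular_values A))"
    by (simp add: singular_values_def)
  with assms show ?thesis
    by (simp add: sorted_rev_nth_mono)
qed

lemma singular_values_nonneg:
  assumes A: "A \<in> carrier_mat n n" and i: "i < n"
  shows "0 \<le> singular_values A ! i"
  using singular_values_diagonalization [OF A] i by (metis nth_mem)

section \<open>Courant-Fischer by functionals, and Weyl's inequality\<close>

text \<open>Some nonzero combination of the first \<open>k + 1\<close> right singular vectors is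
  killed by \<open>k\<close> functionals, and on the span of those vectors \<open>A\<close>
  stretches by at least sigma_(k+1). Lists count from 0, so sigma_(k+1) is entry
  \<open>k\<close>.\<close>

lemma singular_value_le_of_kernel_bound:
  assumes A: "A \<in> carrier_mat n n" and F: "F \<in> carrier_mat k n" and k: "k < n"
    and bound: "\<And>x. x \<in> carrier_vec n \<Longrightarrow> F *\<^sub>v x = 0\<^sub>v k \<Longrightarrow> vnorm (A *\<^sub>v x) \<le> s * vnorm x"
  shows "singular_values A ! k \<le> s"
proof -
  obtain U where U: "U \<in> carrier_mat n n" "mat_adjoint U * U = 1\<^sub>m n"
    and norm: "\<And>x. x \<in> carrier_vec n \<Longrightarrow>
      (vnorm (A *\<^sub>v (U *\<^sub>v x)))\<^sup>2 = (\<Sum>i<n. (singular_values A ! i)\<^sup>2 * (cmod (x $ i))\<^sup>2)"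
    using singular_values_basis [OF A] by blast
  have FU: "F * U \<in> carrier_mat k n" using F U by auto
  \<comment> \<open>A vector in the kernel of \<open>W\<close> gives a combination of the first \<open>k + 1\<close> right singular
    vectors which lies in the kernel of \<open>F\<close>; the zero row makes \<open>W\<close> singular.\<close>
  define W where "W = mat n n (\<lambda>(i, j). if i < k then (F * U) $$ (i, j)
    else if i = k then 0 else if i = j then 1 else 0)"
  have W: "W \<in> carrier_mat n n" by (simp add: W_def)
  have "W = mat\<^sub>r n n (\<lambda>i. if i = k then 0\<^sub>v n else row W i)"
    by (rule eq_matI) (auto simp: W_def)
  moreover have "det (mat\<^sub>r n n (\<lambda>i. if i = k then 0\<^sub>v n else row W i)) = 0"
    using W by (intro det_row_0 [OF k]) (auto intro!: carrier_vecI)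
  ultimately have "det W = 0"
    by simp
  then obtain c where c: "c \<in> carrier_vec n" "c \<noteq> 0\<^sub>v n" "W *\<^sub>v c = 0\<^sub>v n"
    using det_0_iff_vec_prod_zero [OF W] by blast
  have rows: "(\<Sum>j<n. W $$ (i, j) * c $ j) = 0" if "i < n" for i
  proof -
    have "(\<Sum>j<n. W $$ (i, j) * c $ j) = (W *\<^sub>v c) $ i"
      using W c(1) that by (auto simp: scalar_prod_def lessThan_atLeast0)
    then show ?thesis
      using c(3) that by simp
  qed
  \<comment> \<open>Rows of \<open>W\<close> beyond \<open>k\<close> are rows of the identity, which
    forces the later coordinates of \<open>c\<close> to vanish.\<close>
  have tail: "c $ i = 0" if "k < i" "i < n" for i
  proof -
    have "(\<Sum>j<n. W $$ (i, j) * c $ j) = (\<Sum>j<n. if j = i then c $ j else 0)"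
      using that by (intro sum.cong) (auto simp: W_def)
    then show ?thesis
      using rows [of i] that by simp
  qed
  have "F *\<^sub>v (U *\<^sub>v c) = (F * U) *\<^sub>v c"
    using F U c by simp
  also have "\<dots> = 0\<^sub>v k"
  proof (rule eq_vecI)
    fix i assume "i < dim_vec (0\<^sub>v k :: complex vec)"
    then have i: "i < k" by simp
    have "((F * U) *\<^sub>v c) $ i = (\<Sum>j<n. (F * U) $$ (i, j) * c $ j)"
      by (rule index_mult_mat_vec_sum [OF FU c(1) i])
    also have "\<dots> = (\<Sum>j<n. W $$ (i, j) * c $ j)"
      using i k by (intro sum.cong) (auto simp: W_def)
    finally show "((F * U) *\<^sub>v c) $ i = 0\<^sub>v k $ i"
      using i k rows [of i] by simp
  qed (use FU in auto)
  finally have "vnorm (A *\<^sub>v (U *\<^sub>v c)) \<le> s * vnorm c"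
    using bound [of "U *\<^sub>v c"] U c(1) vnorm_unitary [OF U c(1)] by auto
  \<comment> \<open>Since \<open>c\<close> lives on the indices up to \<open>k\<close>, only
    singular values at least as large as entry \<open>k\<close> contribute.\<close>
  moreover have "singular_values A ! k * vnorm c \<le> vnorm (A *\<^sub>v (U *\<^sub>v c))"
  proof (rule power2_le_imp_le)
    have "(singular_values A ! k * vnorm c)\<^sup>2 = (\<Sum>i<n. (singular_values A ! k)\<^sup>2 * (cmod (c $ i))\<^sup>2)"
      using c(1) by (simp add: power_mult_distrib vnorm_sq sum_distrib_left)
    also have "\<dots> \<le> (\<Sum>i<n. (singular_values A ! i)\<^sup>2 * (cmod (c $ i))\<^sup>2)"
    proof (rule sum_mono)
      fix i assume i: "i \<in> {..<n}"
      show "(singular_values A ! k)\<^sup>2 * (cmod (c $ i))\<^sup>2 \<le> (singular_values A ! i)\<^sup>2 * (cmod (c $ i))\<^sup>2"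
      proof (cases "i \<le> k")
        case True
        then have "singular_values A ! k \<le> singular_values A ! i"
          using k by (intro singular_values_antimono) (simp_all add: length_singular_values [OF A])
        then show ?thesis
          using singular_values_nonneg [OF A k] by (intro mult_right_mono power_mono) auto
      next
        case False
        then show ?thesis using tail i by simp
      qed
    qed
    finally show "(singular_values A ! k * vnorm c)\<^sup>2 \<le> (vnorm (A *\<^sub>v (U *\<^sub>v c)))\<^sup>2"
      unfolding norm [OF c(1)] .
  qed simp
  moreover have "0 < vnorm c"
    using c vnorm_eq_0_iff vnorm_nonneg by (metis order_less_le)
  ultimately show ?thesis
    by (meson mult_le_cancel_right_pos order_trans)
qed

text \<open>The converse half. The optimal functionals are the inner products with the first
  \<open>k\<close> right singular vectors, that is, the first \<open>k\<close> rows of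
  \<open>mat_adjoint U\<close>; on their kernel only singular values from entry \<open>k\<close> on
  remain.\<close>

lemma singular_value_kernel_bound:
  assumes A: "A \<in> carrier_mat n n" and k: "k < n"
  obtains F where "F \<in> carrier_mat k n"
    "\<And>x. x \<in> carrier_vec n \<Longrightarrow> F *\<^sub>v x = 0\<^sub>v k \<Longrightarrow>
      vnorm (A *\<^sub>v x) \<le> singular_values A ! k * vnorm x"
proof -
  obtain U where U: "U \<in> carrier_mat n n" "mat_adjoint U * U = 1\<^sub>m n"
    and norm: "\<And>x. x \<in> carrier_vec n \<Longrightarrow>
      (vnorm (A *\<^sub>v (U *\<^sub>v x)))\<^sup>2 = (\<Sum>i<n. (singular_values A ! i)\<^sup>2 * (cmod (x $ i))\<^sup>2)"
    using singular_values_basis [OF A] by blast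
  note U' = mat_adjoint_carrier [OF U(1)]
  have UU': "U * mat_adjoint U = 1\<^sub>m n"
    using mat_mult_left_right_inverse [OF U' U] .
  define F where "F = mat k n (\<lambda>(i, j). mat_adjoint U $$ (i, j))"
  show thesis
  proof (rule that [of F])
    show "F \<in> carrier_mat k n" by (simp add: F_def)
    fix x :: "complex vec" assume x: "x \<in> carrier_vec n" and Fx: "F *\<^sub>v x = 0\<^sub>v k"
    define c where "c = mat_adjoint U *\<^sub>v x"
    have c: "c \<in> carrier_vec n"
      unfolding c_def using U' x by auto
    have Uc: "U *\<^sub>v c = x"
      unfolding c_def using U U' x UU' by (metis assoc_mult_mat_vec one_mult_mat_vec)
    have head: "c $ i = 0" if "i < k" for i
    proof -
      have "row F i = row (mat_adjoint U) i"
        using that k U by (intro eq_vecI) (auto simp: F_def)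
      then have "c $ i = (F *\<^sub>v x) $ i"
        using that k U by (simp add: c_def F_def)
      then show ?thesis
        using that by (simp add: Fx)
    qed
    show "vnorm (A *\<^sub>v x) \<le> singular_values A ! k * vnorm x"
    proof (rule power2_le_imp_le)
      have "(vnorm (A *\<^sub>v x))\<^sup>2 = (\<Sum>i<n. (singular_values A ! i)\<^sup>2 * (cmod (c $ i))\<^sup>2)"
        using norm [OF c] by (simp add: Uc)
      also have "\<dots> \<le> (\<Sum>i<n. (singular_values A ! k)\<^sup>2 * (cmod (c $ i))\<^sup>2)"
      proof (rule sum_mono)
        fix i assume i: "i \<in> {..<n}"
        show "(singular_values A ! i)\<^sup>2 * (cmod (c $ i))\<^sup>2 \<le> (singular_values A ! k)\<^sup>2 * (cmod (c $ i))\<^sup>2"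
        proof (cases "k \<le> i")
          case True
          then have "singular_values A ! i \<le> singular_values A ! k"
            using i by (intro singular_values_antimono) (simp_all add: length_singular_values [OF A])
          then show ?thesis
            using singular_values_nonneg [OF A] i by (intro mult_right_mono power_mono) auto
        next
          case False
          then show ?thesis using head by simp
        qed
      qed
      also have "\<dots> = (singular_values A ! k * vnorm c)\<^sup>2"
        using c by (simp add: power_mult_distrib vnorm_sq sum_distrib_left)
      also have "vnorm c = vnorm x"
        using vnorm_unitary [OF U c] by (simp add: Uc)
      finally show "(vnorm (A *\<^sub>v x))\<^sup>2 \<le> (singular_values A ! k * vnorm x)\<^sup>2" .
    qed (use singular_values_nonneg [OF A k] in auto)
  qed
qed

text \<open>The functionals that are optimal for \<open>B\<close> are tested on \<open>A\<close>; on
  their kernel the two images differ by at most the norm of the perturbation. The one-sided form is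
  applied in both directions later.\<close>

lemma singular_value_perturbation:
  assumes A: "A \<in> carrier_mat n n" and B: "B \<in> carrier_mat n n" and k: "k < n"
    and bound: "\<And>i j. i < n \<Longrightarrow> j < n \<Longrightarrow> cmod (A $$ (i, j) - B $$ (i, j)) \<le> c"
  shows "singular_values A ! k \<le> singular_values B ! k + real n * c"
proof -
  obtain F where F: "F \<in> carrier_mat k n"
    and FB: "\<And>x. x \<in> carrier_vec n \<Longrightarrow> F *\<^sub>v x = 0\<^sub>v k \<Longrightarrow>
      vnorm (B *\<^sub>v x) \<le> singular_values B ! k * vnorm x"
    using singular_value_kernel_bound [OF B k] by blast
  show ?thesis
  proof (rule singular_value_le_of_kernel_bound [OF A F k])
    fix x :: "complex vec" assume x: "x \<in> carrier_vec n" and Fx: "F *\<^sub>v x = 0\<^sub>v k"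
    have "A *\<^sub>v x = B *\<^sub>v x + (A - B) *\<^sub>v x"
      using A B x by (subst minus_mult_distrib_mat_vec [OF A B x]) (intro eq_vecI; auto)
    also have "vnorm \<dots> \<le> vnorm (B *\<^sub>v x) + vnorm ((A - B) *\<^sub>v x)"
      using A B x by (intro vnorm_triangle mult_mat_vec_carrier minus_carrier_mat)
    also have "vnorm ((A - B) *\<^sub>v x) \<le> real n * c * vnorm x"
      using A B x bound by (intro vnorm_mult_mat_vec_le) auto
    finally show "vnorm (A *\<^sub>v x) \<le> (singular_values B ! k + real n * c) * vnorm x"
      using FB [OF x Fx] by (simp add: algebra_simps)
  qed
qed

lemma singular_value_zero_of_kernel:
  assumes A: "A \<in> carrier_mat n n" and F: "F \<in> carrier_mat k n" and k: "k < n"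
    and ker: "\<And>x. x \<in> carrier_vec n \<Longrightarrow> F *\<^sub>v x = 0\<^sub>v k \<Longrightarrow> A *\<^sub>v x = 0\<^sub>v n"
  shows "singular_values A ! k = 0"
proof (rule antisym)
  show "singular_values A ! k \<le> 0"
    using vnorm_eq_0_iff [of "0\<^sub>v n" n]
    by (intro singular_value_le_of_kernel_bound [OF A F k]) (simp add: ker)
qed (rule singular_values_nonneg [OF A k])

section \<open>The Green's function of the disk\<close>

text \<open>A relation rather than an iterated \<open>deriv\<close>: it follows from
  \<open>C2_on\<close> for the abstract \<open>G\<close> and from explicit formulas for logarithms,
  and it is stable under linear combinations.\<close>

definition has_second_deriv :: "(real \<Rightarrow> real) \<Rightarrow> real \<Rightarrow> bool" where
  "has_second_deriv f a \<longleftrightarrow>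
     (\<exists>f'. (\<forall>\<^sub>F t in nhds 0. (f has_real_derivative f' t) (at t)) \<and> (f' has_real_derivative a) (at 0))"

lemma has_second_deriv_lincomb:
  assumes "has_second_deriv f a" "has_second_deriv g b"
  shows "has_second_deriv (\<lambda>t. c * f t + d * g t) (c * a + d * b)"
proof -
  obtain f' g' where f: "\<forall>\<^sub>F t in nhds 0. (f has_real_derivative f' t) (at t)"
    and f': "(f' has_real_derivative a) (at 0)"
    and g: "\<forall>\<^sub>F t in nhds 0. (g has_real_derivative g' t) (at t)"
    and g': "(g' has_real_derivative b) (at 0)"
    using assms unfolding has_second_deriv_def by blast
  have "\<forall>\<^sub>F t in nhds 0. ((\<lambda>t. c * f t + d * g t) has_real_derivative c * f' t + d * g' t) (at t)"
    using f g by eventually_elim (auto intro!: derivative_eq_intros)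
  moreover have "((\<lambda>t. c * f' t + d * g' t) has_real_derivative c * a + d * b) (at 0)"
    using f' g' by (auto intro!: derivative_eq_intros)
  ultimately show ?thesis
    unfolding has_second_deriv_def by (intro exI [of _ "\<lambda>t. c * f' t + d * g' t"]) auto
qed

text \<open>At a maximum \<open>f' 0 = 0\<close>. If \<open>a\<close> were positive,
  \<open>f'\<close> would be positive just to the right of 0, and the mean value theorem would make
  \<open>f\<close> increase there.\<close>

lemma has_second_deriv_local_max:
  assumes "has_second_deriv f a" and max: "\<forall>\<^sub>F t in nhds 0. f t \<le> f 0"
  shows "a \<le> 0"
proof (rule ccontr)
  assume "\<not> a \<le> 0"
  obtain f' where f: "\<forall>\<^sub>F t in nhds 0. (f has_real_derivative f' t) (at t)"
    and f': "(f' has_real_derivative a) (at 0)"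
    using assms(1) unfolding has_second_deriv_def by blast
  have "\<forall>\<^sub>F t in nhds 0. (f has_real_derivative f' t) (at t) \<and> f t \<le> f 0"
    using f max by eventually_elim auto
  then obtain r where r: "0 < r"
    and near: "\<And>t. \<bar>t\<bar> < r \<Longrightarrow> (f has_real_derivative f' t) (at t) \<and> f t \<le> f 0"
    unfolding eventually_nhds_metric by (auto simp: dist_real_def)
  have "f' 0 = 0"
    using near [of 0] near r by (intro DERIV_local_max [of f "f' 0" 0 r]) auto
  obtain d where d: "0 < d" and inc: "\<And>h. 0 < h \<Longrightarrow> h < d \<Longrightarrow> f' 0 < f' h"
    using DERIV_pos_inc_right [OF f'] \<open>\<not> a \<le> 0\<close> by auto
  define h where "h = min r d / 2"
  have h: "0 < h" "h < r" "h < d"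
    using r d by (auto simp: h_def)
  obtain z where z: "0 < z" "z < h" and "f h - f 0 = (h - 0) * f' z"
    using MVT2 [of 0 h f f'] near h by auto
  moreover have "0 < f' z"
    using inc [of z] z h \<open>f' 0 = 0\<close> by simp
  ultimately have "f 0 < f h"
    using h by (metis diff_gt_0_iff_gt diff_zero mult_pos_pos)
  then show False
    using near [of h] h by simp
qed

definition harmonic_at :: "(complex \<Rightarrow> real) \<Rightarrow> complex \<Rightarrow> bool" where
  "harmonic_at u z \<longleftrightarrow> (\<exists>a b. has_second_deriv (\<lambda>t. u (z + of_real t)) a \<and>
     has_second_deriv (\<lambda>t. u (z + \<i> * of_real t)) b \<and> a + b = 0)"

lemma harmonic_at_lincomb:
  assumes "harmonic_at u z" "harmonic_at v z"
  shows "harmonic_at (\<lambda>x. c * u x + d * v x) z"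
proof -
  obtain a b a' b' where
    "has_second_deriv (\<lambda>t. u (z + of_real t)) a" "has_second_deriv (\<lambda>t. u (z + \<i> * of_real t)) b"
    "has_second_deriv (\<lambda>t. v (z + of_real t)) a'" "has_second_deriv (\<lambda>t. v (z + \<i> * of_real t)) b'"
    and sum: "a + b = 0" "a' + b' = 0"
    using assms unfolding harmonic_at_def by blast
  then have
    "has_second_deriv (\<lambda>t. c * u (z + of_real t) + d * v (z + of_real t)) (c * a + d * a')"
    "has_second_deriv (\<lambda>t. c * u (z + \<i> * of_real t) + d * v (z + \<i> * of_real t)) (c * b + d * b')"
    by (auto intro: has_second_deriv_lincomb)
  moreover have "(c * a + d * a') + (c * b + d * b') = 0"
    using sum unfolding add_eq_0_iff by (simp add: algebra_simps)
  ultimately show ?thesis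
    unfolding harmonic_at_def by blast
qed

lemma has_real_derivative_along_line:
  fixes u :: "complex \<Rightarrow> real" and w :: complex
  assumes "open S" "u differentiable_on S" "z + w * of_real t \<in> S"
  shows "((\<lambda>s. u (z + w * of_real s)) has_real_derivative
    deriv (\<lambda>s. u (z + w * of_real t + w * of_real s)) 0) (at t)"
proof -
  have u: "u differentiable (at (z + w * of_real t))"
    using assms by (metis at_within_open differentiable_on_def)
  have "(\<lambda>s. u (z + w * of_real t + w * of_real s)) differentiable (at (0 :: real))"
  proof (rule differentiable_compose [where f = u])
    show "u differentiable at (z + w * of_real t + w * of_real 0)"
      using u by simp
    show "(\<lambda>s. z + w * of_real t + w * of_real s) differentiable at (0 :: real)"
      by (intro differentiable_add differentiable_const bounded_linear_imp_differentiable
          bounded_linear_compose [OF bounded_linear_mult_right bounded_linear_of_real])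
  qed
  then have "((\<lambda>s. u (z + w * of_real t + w * of_real s)) has_real_derivative
      deriv (\<lambda>s. u (z + w * of_real t + w * of_real s)) 0) (at 0)"
    by (metis DERIV_imp_deriv real_differentiable_def)
  moreover have "(\<lambda>s. u (z + w * of_real t + w * of_real s)) = (\<lambda>s. u (z + w * of_real (s + t)))"
    by (simp add: algebra_simps)
  ultimately show ?thesis
    using DERIV_shift [of "\<lambda>s. u (z + w * of_real s)" _ 0 t] by simp
qed

text \<open>The direction \<open>w\<close> treats both axes at once: \<open>D\<close> is
  \<open>partial_x\<close> for \<open>w = 1\<close> and \<open>partial_y\<close> for
  \<open>w = \<i>\<close>.\<close>

lemma has_second_deriv_along_line:
  fixes u :: "complex \<Rightarrow> real" and w :: complex
  defines "D \<equiv> \<lambda>f z. deriv (\<lambda>t. f (z + w * of_real t)) 0"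
  assumes S: "open S" "z \<in> S" and u: "u differentiable_on S" "D u differentiable_on S"
  shows "has_second_deriv (\<lambda>t. u (z + w * of_real t)) (D (D u) z)"
proof -
  have "((\<lambda>t. z + w * of_real t) \<longlongrightarrow> z + w * of_real 0) (nhds 0)"
    by (intro tendsto_intros filterlim_ident)
  then have "\<forall>\<^sub>F t in nhds 0. z + w * of_real t \<in> S"
    using S by (auto elim: topological_tendstoD)
  then have "\<forall>\<^sub>F t in nhds 0. ((\<lambda>t. u (z + w * of_real t)) has_real_derivative
      D u (z + w * of_real t)) (at t)"
    unfolding D_def by eventually_elim (rule has_real_derivative_along_line [OF S(1) u(1)])
  moreover have "((\<lambda>t. D u (z + w * of_real t)) has_real_derivative D (D u) z) (at 0)"
    using has_real_derivative_along_line [OF S(1) u(2), of z w 0] S(2)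
    unfolding D_def by simp
  ultimately show ?thesis
    unfolding has_second_deriv_def by (intro exI [of _ "\<lambda>t. D u (z + w * of_real t)"] conjI)
qed

lemma harmonic_at_C2_on:
  assumes "open S" "z \<in> S" "C2_on S u" "laplacian u z = 0"
  shows "harmonic_at u z"
proof -
  have px: "partial_x = (\<lambda>f z. deriv (\<lambda>t. f (z + 1 * of_real t)) 0)"
    by (intro ext) (simp add: partial_x_def)
  have py: "partial_y = (\<lambda>f z. deriv (\<lambda>t. f (z + \<i> * of_real t)) 0)"
    by (intro ext) (simp add: partial_y_def)
  have "has_second_deriv (\<lambda>t. u (z + 1 * of_real t)) (partial_x (partial_x u) z)"
    unfolding px using assms
    by (intro has_second_deriv_along_line) (auto simp: C2_on_def C1_on_def px)
  moreover have "has_second_deriv (\<lambda>t. u (z + \<i> * of_real t)) (partial_y (partial_y u) z)"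
    unfolding py using assms
    by (intro has_second_deriv_along_line) (auto simp: C2_on_def C1_on_def py)
  ultimately show ?thesis
    using assms(4) unfolding harmonic_at_def laplacian_def by auto
qed

text \<open>Along a line the squared modulus is a real quadratic \<open>P\<close>, so the logarithm
  of the modulus is half of \<open>ln P\<close>.\<close>

lemma has_second_deriv_ln_cmod:
  assumes "A \<noteq> 0"
  shows "has_second_deriv (\<lambda>t. ln (cmod (A + c * of_real t)))
    (((cmod c)\<^sup>2 * (cmod A)\<^sup>2 - 2 * (Re (c * cnj A))\<^sup>2) / (cmod A) ^ 4)"
proof -
  define G R where "G = (cmod c)\<^sup>2" and "R = Re (c * cnj A)"
  define P where "P t = (cmod A)\<^sup>2 + 2 * t * R + t\<^sup>2 * G" for t
  have P: "(cmod (A + c * of_real t))\<^sup>2 = P t" for t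
    unfolding P_def G_def R_def cmod_power2 by (simp add: algebra_simps power2_eq_square)
  have P0: "P 0 = (cmod A)\<^sup>2" "0 < P 0"
    using assms by (auto simp: P_def)
  have "open {t. 0 < P t}"
    unfolding P_def by (intro open_Collect_less continuous_intros)
  then have pos: "\<forall>\<^sub>F t in nhds 0. 0 < P t"
    using P0 eventually_nhds_in_open [of "{t. 0 < P t}" 0] by simp
  \<comment> \<open>The identity holds even where the argument vanishes, because
    \<open>ln 0 = 0\<close>; hence it can rewrite the whole function.\<close>
  have ln: "ln (cmod (A + c * of_real t)) = ln (P t) / 2" for t
  proof (cases "A + c * of_real t = 0")
    case False
    then show ?thesis
      unfolding P [symmetric] by (subst ln_realpow) auto
  qed (use P [of t] in auto)
  have "\<forall>\<^sub>F t in nhds 0. ((\<lambda>t. ln (P t) / 2) has_real_derivative (R + t * G) / P t) (at t)"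
    using pos
  proof eventually_elim
    case (elim t)
    have "(P has_real_derivative 2 * R + 2 * t * G) (at t)"
      unfolding P_def by (auto intro!: derivative_eq_intros)
    with elim show ?case
      by (auto intro!: derivative_eq_intros simp: field_simps)
  qed
  moreover have "((\<lambda>t. (R + t * G) / P t) has_real_derivative
      (G * (cmod A)\<^sup>2 - 2 * R\<^sup>2) / (cmod A) ^ 4) (at 0)"
  proof -
    have "(P has_real_derivative 2 * R) (at 0)"
      unfolding P_def by (auto intro!: derivative_eq_intros)
    with P0(2) have "((\<lambda>t. (R + t * G) / P t) has_real_derivative
        (G * P 0 - R * (2 * R)) / (P 0 * P 0)) (at 0)"
      by (auto intro!: derivative_eq_intros)
    moreover have "P 0 * P 0 = (cmod A) ^ 4"
      unfolding P0(1) by (simp add: power2_eq_square power4_eq_xxxx)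
    ultimately show ?thesis
      by (simp add: P0(1) power2_eq_square [of R] mult.left_commute)
  qed
  ultimately show ?thesis
    unfolding has_second_deriv_def ln G_def [symmetric] R_def [symmetric]
    by (intro exI [of _ "\<lambda>t. (R + t * G) / P t"] conjI)
qed

text \<open>Replacing direction \<open>b\<close> by \<open>\<i> * b\<close> turns
  \<open>Re (b * cnj A)\<close> into minus the imaginary part. The two squares then add up to |b|^2
  |A|^2 and the second derivatives cancel.\<close>

lemma harmonic_at_ln_cmod:
  assumes "a + b * z \<noteq> 0"
  shows "harmonic_at (\<lambda>x. ln (cmod (a + b * x))) z"
proof -
  define A where "A = a + b * z"
  have line: "a + b * (z + of_real t) = A + b * of_real t"
    "a + b * (z + \<i> * of_real t) = A + (\<i> * b) * of_real t" for t
    by (simp_all add: A_def algebra_simps)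
  have "(cmod b)\<^sup>2 * (cmod A)\<^sup>2 = (Re (b * cnj A))\<^sup>2 + (Re (\<i> * b * cnj A))\<^sup>2"
    unfolding power_mult_distrib [symmetric]
    by (simp add: cmod_power2 power_mult_distrib) (simp add: algebra_simps power2_eq_square)
  then have "((cmod b)\<^sup>2 * (cmod A)\<^sup>2 - 2 * (Re (b * cnj A))\<^sup>2) / (cmod A) ^ 4 +
      ((cmod (\<i> * b))\<^sup>2 * (cmod A)\<^sup>2 - 2 * (Re (\<i> * b * cnj A))\<^sup>2) / (cmod A) ^ 4 = 0"
    unfolding add_divide_distrib [symmetric] by (simp add: norm_mult)
  moreover have "A \<noteq> 0"
    using assms by (simp add: A_def)
  ultimately show ?thesis
    unfolding harmonic_at_def line
    using has_second_deriv_ln_cmod [of A b] has_second_deriv_ln_cmod [of A "\<i> * b"] by blast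
qed

section \<open>Maximum principle and uniqueness of the Green's function\<close>

text \<open>Adding \<delta> |z|^2 raises each second derivative by 2 \<delta>. At an interior
  maximum both must be at most 0, yet they sum to 4 \<delta> > 0.\<close>

lemma punctured_disk_maximum_principle:
  fixes v :: "complex \<Rightarrow> real"
  assumes y: "y \<in> ball 0 1"
    and cont: "continuous_on (cball 0 1 - {y}) v"
    and harm: "\<And>z. z \<in> ball 0 1 - {y} \<Longrightarrow> harmonic_at v z"
    and bdry: "\<And>z. z \<in> sphere 0 1 \<Longrightarrow> v z \<le> 0"
    and near: "\<forall>\<^sub>F z in at y. v z \<le> 0"
    and z0: "z0 \<in> cball 0 1 - {y}"
  shows "v z0 \<le> 0"
proof (rule ccontr)
  assume "\<not> v z0 \<le> 0"
  then have pos: "0 < v z0" by simp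
  obtain d where d: "0 < d" and vd: "\<And>z. z \<noteq> y \<Longrightarrow> dist z y < d \<Longrightarrow> v z \<le> 0"
    using near unfolding eventually_at by blast
  \<comment> \<open>Half of \<open>d\<close>, so that \<open>v\<close> is nonpositive on the closed
    disk around \<open>y\<close>, including the inner boundary of \<open>K\<close>.\<close>
  define r where "r = d / 2"
  define K where "K = cball 0 1 - ball y r"
  have K: "compact K"
    unfolding K_def by (intro compact_diff) auto
  have sub: "K \<subseteq> cball 0 1 - {y}"
    using d by (auto simp: K_def r_def)
  have z0K: "z0 \<in> K"
    using z0 vd [of z0] pos d by (auto simp: K_def r_def dist_commute)
  \<comment> \<open>Small enough that the added term, at most \<delta> on the disk, leaves
    \<open>v\<close> positive at a maximum of \<open>w\<close>; this excludes both boundary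
    circles.\<close>
  define \<delta> where "\<delta> = v z0 / 2"
  define w where "w z = 1 * v z + \<delta> * (cmod z)\<^sup>2" for z
  have "continuous_on K w"
    unfolding w_def by (intro continuous_intros continuous_on_subset [OF cont sub])
  then obtain z where zK: "z \<in> K" and max: "\<And>x. x \<in> K \<Longrightarrow> w x \<le> w z"
    using continuous_attains_sup [OF K] z0K by blast
  have "v z0 \<le> w z0"
    using pos by (simp add: w_def \<delta>_def)
  with max [OF z0K] have wz: "v z0 \<le> w z" by simp
  have "\<delta> * (cmod z)\<^sup>2 \<le> \<delta> * 1"
    using zK pos by (intro mult_left_mono) (auto simp: K_def \<delta>_def power_le_one)
  then have vz: "0 < v z"
    using wz pos unfolding w_def \<delta>_def by linarith
  have "z \<in> ball 0 1 - cball y r"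
  proof -
    have "z \<notin> sphere 0 1"
      using bdry [of z] vz by auto
    moreover have "z \<notin> cball y r"
      using vd [of z] vz subsetD [OF sub zK] d by (auto simp: r_def dist_commute)
    ultimately show ?thesis
      using zK by (auto simp: K_def)
  qed
  then have "\<forall>\<^sub>F x in nhds z. x \<in> ball 0 1 - cball y r"
    by (intro eventually_nhds_in_open) auto
  then have loc: "\<forall>\<^sub>F x in nhds z. w x \<le> w z"
    by eventually_elim (auto intro!: max simp: K_def)
  have line: "\<forall>\<^sub>F t in nhds 0. w (z + c * of_real t) \<le> w (z + c * of_real 0)" for c
  proof -
    have "((\<lambda>t. z + c * of_real t) \<longlongrightarrow> z + c * of_real 0) (nhds 0)"
      by (intro tendsto_intros filterlim_ident)
    then have "filterlim (\<lambda>t. z + c * of_real t) (nhds z) (nhds 0)" by simp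
    then show ?thesis
      using eventually_compose_filterlim [OF loc] by simp
  qed
  have sq: "has_second_deriv (\<lambda>t. (cmod (z + c * of_real t))\<^sup>2) 2" if "cmod c = 1" for c
  proof -
    have eq: "(cmod (z + c * of_real t))\<^sup>2 = (cmod z)\<^sup>2 + 2 * t * Re (c * cnj z) + t\<^sup>2" for t
    proof -
      have "(cmod (z + c * of_real t))\<^sup>2 = (cmod z)\<^sup>2 + 2 * t * Re (c * cnj z) + t\<^sup>2 * (cmod c)\<^sup>2"
        unfolding cmod_power2 by (simp add: algebra_simps power2_eq_square)
      then show ?thesis using that by simp
    qed
    show ?thesis
      unfolding has_second_deriv_def eq
      by (rule exI [of _ "\<lambda>t. 2 * Re (c * cnj z) + 2 * t"])
         (auto intro!: derivative_eq_intros always_eventually)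
  qed
  obtain a b where ab: "has_second_deriv (\<lambda>t. v (z + of_real t)) a"
    "has_second_deriv (\<lambda>t. v (z + \<i> * of_real t)) b" "a + b = 0"
    using harm [of z] \<open>z \<in> ball 0 1 - cball y r\<close> subsetD [OF sub zK]
    unfolding harmonic_at_def by auto
  have "has_second_deriv (\<lambda>t. w (z + of_real t)) (1 * a + \<delta> * 2)"
    unfolding w_def using sq [of 1] by (intro has_second_deriv_lincomb ab) simp
  from has_second_deriv_local_max [OF this] line [of 1] have "a + \<delta> * 2 \<le> 0" by simp
  have "has_second_deriv (\<lambda>t. w (z + \<i> * of_real t)) (1 * b + \<delta> * 2)"
    unfolding w_def using sq [of \<i>] by (intro has_second_deriv_lincomb ab) simp
  from has_second_deriv_local_max [OF this] line [of \<i>] have "b + \<delta> * 2 \<le> 0" by simp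
  with \<open>a + \<delta> * 2 \<le> 0\<close> ab(3) pos show False
    by (simp add: \<delta>_def)
qed

text \<open>Method of images: for nonzero \<open>y\<close> the first logarithm belongs to an
  opposite charge at 1 / cnj y, scaled by |y|. Written without the division it also covers
  \<open>y = 0\<close>.\<close>

definition disk_green :: "complex \<Rightarrow> complex \<Rightarrow> real" where
  "disk_green x y = (ln (cmod (1 - cnj y * x)) - ln (cmod (x - y))) / (2 * pi)"

lemma one_minus_cnj_mult_neq_0:
  assumes "y \<in> ball 0 1" "x \<in> cball 0 1"
  shows "1 - cnj y * x \<noteq> 0"
proof
  assume "1 - cnj y * x = 0"
  then have "cmod y * cmod x = 1"
    by (metis complex_mod_cnj eq_iff_diff_eq_0 norm_mult norm_one)
  moreover have "cmod y * cmod x \<le> cmod y * 1"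
    using assms by (intro mult_left_mono) auto
  ultimately show False
    using assms by simp
qed

text \<open>With \<open>x * cnj x = 1\<close> the left-hand argument is
  \<open>x * cnj (x - y)\<close>. This gives the zero boundary values of
  \<open>disk_green\<close>.\<close>

lemma cmod_one_minus_cnj_mult:
  assumes "cmod x = 1"
  shows "cmod (1 - cnj y * x) = cmod (x - y)"
proof -
  have "1 - cnj y * x = x * cnj (x - y)"
    using complex_norm_square [of x] assms by (simp add: algebra_simps)
  then show ?thesis
    using assms by (metis complex_mod_cnj mult_1 norm_mult)
qed

lemma disk_green_at_pole:
  assumes y: "y \<in> ball 0 1"
  shows "filterlim (\<lambda>x. disk_green x y) at_top (at y)"
    and "Bfun (\<lambda>x. disk_green x y + ln (cmod (x - y)) / (2 * pi)) (at y)"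
proof -
  have lim: "((\<lambda>x. ln (cmod (1 - cnj y * x)) / (2 * pi)) \<longlongrightarrow>
      ln (cmod (1 - cnj y * y)) / (2 * pi)) (at y)"
    using one_minus_cnj_mult_neq_0 [OF y, of y] y by (intro tendsto_intros) auto
  have eq: "disk_green x y + ln (cmod (x - y)) / (2 * pi) = ln (cmod (1 - cnj y * x)) / (2 * pi)" for x
    by (simp add: disk_green_def diff_divide_distrib)
  show "Bfun (\<lambda>x. disk_green x y + ln (cmod (x - y)) / (2 * pi)) (at y)"
    unfolding eq
    by (rule BfunI [OF eventually_mono [OF order_tendstoD(2) [OF tendsto_norm [OF lim] less_add_one]]])
       (rule less_imp_le)
  have "filterlim (\<lambda>x. cmod (x - y)) (at_right 0) (at y)"
  proof (rule filterlim_at_withinI)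
    have "((\<lambda>x. cmod (x - y)) \<longlongrightarrow> cmod (y - y)) (at y)"
      by (intro tendsto_intros)
    then show "((\<lambda>x. cmod (x - y)) \<longlongrightarrow> 0) (at y)" by simp
    show "\<forall>\<^sub>F x in at y. cmod (x - y) \<in> {0<..} - {0}"
      by (auto simp: eventually_at intro!: exI [of _ 1])
  qed
  then have "filterlim (\<lambda>x. ln (cmod (x - y))) at_bot (at y)"
    by (rule filterlim_compose [OF ln_at_0])
  then have "filterlim (\<lambda>x. (1 / (2 * pi)) * - ln (cmod (x - y))) at_top (at y)"
    by (intro filterlim_tendsto_pos_mult_at_top [OF tendsto_const])
       (auto simp: filterlim_uminus_at_top)
  from filterlim_tendsto_add_at_top [OF lim this]
  show "filterlim (\<lambda>x. disk_green x y) at_top (at y)"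
    by (simp add: disk_green_def diff_divide_distrib)
qed

lemma dirichlet_green_eq_disk_green:
  assumes G: "dirichlet_green 0 G" and y: "y \<in> ball 0 1" and x: "x \<in> cball 0 1 - {y}"
  shows "G x y = disk_green x y"
proof -
  have C2: "C2_on (ball 0 1 - {y}) (\<lambda>x. G x y)"
    and lap: "\<And>z. z \<in> ball 0 1 - {y} \<Longrightarrow> laplacian (\<lambda>x. G x y) z = 0"
    and bfun: "Bfun (\<lambda>x. G x y + ln (cmod (x - y)) / (2 * pi)) (at y)"
    and cont: "continuous_on (cball 0 1 - {y}) (\<lambda>x. G x y)"
    and bdry: "\<And>z. z \<in> sphere 0 1 \<Longrightarrow> G z y = 0"
    using G y unfolding dirichlet_green_def by auto
  define \<Phi> where "\<Phi> z = disk_green z y" for z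
  have neq: "1 - cnj y * z \<noteq> 0" if "z \<in> cball 0 1" for z
    using one_minus_cnj_mult_neq_0 [OF y that] .
  have contG: "continuous_on (cball 0 1 - {y}) \<Phi>"
    unfolding \<Phi>_def disk_green_def using neq by (intro continuous_intros) auto
  have harmG: "harmonic_at \<Phi> z" if "z \<in> ball 0 1 - {y}" for z
  proof -
    have "harmonic_at (\<lambda>x. 1 / (2 * pi) * ln (cmod (1 + (- cnj y) * x))
        + - 1 / (2 * pi) * ln (cmod (- y + 1 * x))) z"
      using that neq [of z] by (intro harmonic_at_lincomb harmonic_at_ln_cmod) auto
    then show ?thesis
      unfolding \<Phi>_def disk_green_def by (simp add: diff_divide_distrib)
  qed
  have bdryG: "\<Phi> z = 0" if "z \<in> sphere 0 1" for z
    using cmod_one_minus_cnj_mult [of z y] that by (simp add: \<Phi>_def disk_green_def)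
  have harm: "harmonic_at (\<lambda>x. G x y) z" if "z \<in> ball 0 1 - {y}" for z
    using C2 lap that by (intro harmonic_at_C2_on [of "ball 0 1 - {y}"]) auto
  obtain K where K: "\<forall>\<^sub>F z in at y. \<bar>G z y - \<Phi> z\<bar> \<le> K"
  proof -
    obtain K1 where K1: "\<forall>\<^sub>F z in at y. norm (G z y + ln (cmod (z - y)) / (2 * pi)) \<le> K1"
      using bfun unfolding Bfun_def by blast
    obtain K2 where K2: "\<forall>\<^sub>F z in at y. norm (\<Phi> z + ln (cmod (z - y)) / (2 * pi)) \<le> K2"
      using disk_green_at_pole(2) [OF y] unfolding Bfun_def \<Phi>_def by blast
    have "\<forall>\<^sub>F z in at y. \<bar>G z y - \<Phi> z\<bar> \<le> K1 + K2"
      using K1 K2 by eventually_elim (auto simp: abs_le_iff)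
    then show thesis by (rule that)
  qed
  \<comment> \<open>Any multiple of the pole of \<open>\<Phi>\<close> dominates the bounded difference near \<open>y\<close>.\<close>
  have key: "s * (G x y - \<Phi> x) \<le> e * \<Phi> x" if s: "\<bar>s\<bar> = 1" and e: "0 < e" for s e :: real
  proof -
    \<comment> \<open>This is s (G - \<Phi>) - e \<Phi>, arranged as a linear combination; the sign
      \<open>s\<close> yields both inequalities from one argument.\<close>
    define v where "v z = s * G z y + (- s - e) * \<Phi> z" for z
    have "v x \<le> 0"
    proof (rule punctured_disk_maximum_principle [OF y _ _ _ _ x])
      show "continuous_on (cball 0 1 - {y}) v"
        unfolding v_def by (intro continuous_intros cont contG)
      show "harmonic_at v z" if "z \<in> ball 0 1 - {y}" for z
        unfolding v_def by (intro harmonic_at_lincomb harm harmG that)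
      show "v z \<le> 0" if "z \<in> sphere 0 1" for z
        using that by (simp add: v_def bdry bdryG)
      have "\<forall>\<^sub>F z in at y. K / e \<le> \<Phi> z"
        using disk_green_at_pole(1) [OF y] unfolding \<Phi>_def filterlim_at_top by blast
      with K show "\<forall>\<^sub>F z in at y. v z \<le> 0"
      proof eventually_elim
        case (elim z)
        have "s * (G z y - \<Phi> z) \<le> \<bar>G z y - \<Phi> z\<bar>"
          using s by (metis abs_ge_self abs_mult mult_1)
        also have "\<dots> \<le> e * \<Phi> z"
          using elim e by (simp add: divide_le_eq mult.commute)
        finally show ?case
          by (simp add: v_def algebra_simps)
      qed
    qed
    then show ?thesis
      by (simp add: v_def algebra_simps)
  qed
  have "s * (G x y - \<Phi> x) \<le> 0" if s: "\<bar>s\<bar> = 1" for s :: real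
  proof (rule ccontr)
    assume "\<not> s * (G x y - \<Phi> x) \<le> 0"
    then have pos: "0 < s * (G x y - \<Phi> x)" by simp
    \<comment> \<open>The limit e -> 0 at the fixed point \<open>x\<close>: \<open>b\<close> is a
      positive bound for \<open>\<Phi> x\<close>, and \<open>e\<close> is chosen so that
      \<open>e * b\<close> is half of the quantity assumed positive.\<close>
    define b where "b = \<bar>\<Phi> x\<bar> + 1"
    define e where "e = s * (G x y - \<Phi> x) / (2 * b)"
    have b: "0 < b" "\<Phi> x \<le> b"
      by (auto simp: b_def)
    have e: "0 < e"
      using pos b by (simp add: e_def)
    have "s * (G x y - \<Phi> x) \<le> e * b"
      using key [OF s e] mult_left_mono [OF b(2), of e] e by linarith
    also have "\<dots> = s * (G x y - \<Phi> x) / 2"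
      using b by (simp add: e_def)
    finally show False
      using pos by simp
  qed
  from this [of 1] this [of "- 1"] show ?thesis
    by (simp add: \<Phi>_def)
qed

section \<open>The boundary flux of one source\<close>

text \<open>Along the ray, \<open>P\<close> and \<open>Q\<close> are the squared moduli in the two
  logarithms. They agree at \<open>r = 1\<close>, so the two logarithmic derivatives share a
  denominator and \<open>a\<close> cancels.\<close>

lemma normal_derivative_dirichlet_green:
  assumes G: "dirichlet_green 0 G" and y: "y \<in> ball 0 1"
  shows "normal_derivative (\<lambda>x. G x y) \<theta> = - (1 - (cmod y)\<^sup>2) / (2 * pi * (cmod (cis \<theta> - y))\<^sup>2)"
proof -
  define a b where "a = Re (cnj y * cis \<theta>)" and "b = (cmod y)\<^sup>2"
  define P Q where "P r = 1 - 2 * r * a + r\<^sup>2 * b" and "Q r = r\<^sup>2 - 2 * r * a + b" for r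
  define C S where "C = cos \<theta>" and "S = sin \<theta>"
  have sq: "C\<^sup>2 + S\<^sup>2 = 1"
    by (simp add: C_def S_def)
  have a: "a = Re y * C + Im y * S" and b: "b = (Re y)\<^sup>2 + (Im y)\<^sup>2"
    by (simp_all add: a_def b_def C_def S_def cmod_power2)
  have P: "(cmod (1 - cnj y * (of_real r * cis \<theta>)))\<^sup>2 = P r" for r
  proof -
    have "(cmod (1 - cnj y * (of_real r * cis \<theta>)))\<^sup>2 =
        (1 - r * (Re y * C + Im y * S))\<^sup>2 + (r * (Im y * C - Re y * S))\<^sup>2"
      unfolding cmod_power2 C_def S_def
      by (intro arg_cong2 [where f = "(+)"] arg_cong [where f = "\<lambda>x. x\<^sup>2"])
         (simp_all add: algebra_simps)
    also have "\<dots> = 1 - 2 * r * a + r\<^sup>2 * (((Re y)\<^sup>2 + (Im y)\<^sup>2) * (C\<^sup>2 + S\<^sup>2))"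
      unfolding a by (simp add: power2_eq_square algebra_simps)
    also have "\<dots> = P r"
      unfolding sq P_def b by simp
    finally show ?thesis .
  qed
  have Q: "(cmod (of_real r * cis \<theta> - y))\<^sup>2 = Q r" for r
  proof -
    have "(cmod (of_real r * cis \<theta> - y))\<^sup>2 = (r * C - Re y)\<^sup>2 + (r * S - Im y)\<^sup>2"
      unfolding cmod_power2 C_def S_def by simp
    also have "\<dots> = r\<^sup>2 * (C\<^sup>2 + S\<^sup>2) - 2 * r * a + ((Re y)\<^sup>2 + (Im y)\<^sup>2)"
      unfolding a by (simp add: power2_eq_square algebra_simps)
    also have "\<dots> = Q r"
      unfolding sq Q_def b by simp
    finally show ?thesis .
  qed
  have Q1: "0 < Q 1"
  proof -
    have "cis \<theta> \<noteq> y" using y by auto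
    then show ?thesis
      unfolding Q [symmetric] by simp
  qed
  have PQ: "P 1 = Q 1"
    by (simp add: P_def Q_def)
  have "(P has_real_derivative - 2 * a + 2 * b) (at 1)" "(Q has_real_derivative 2 - 2 * a) (at 1)"
    unfolding P_def Q_def by (auto intro!: derivative_eq_intros)
  then have "((\<lambda>r. ln (P r)) has_real_derivative (- 2 * a + 2 * b) / P 1) (at 1)"
    "((\<lambda>r. ln (Q r)) has_real_derivative (2 - 2 * a) / Q 1) (at 1)"
    using Q1 PQ by (auto intro!: derivative_eq_intros)
  \<comment> \<open>The 4 pi is 2 pi doubled, since \<open>P\<close> and \<open>Q\<close> are
    squares of the moduli.\<close>
  then have "((\<lambda>r. (ln (P r) - ln (Q r)) / (4 * pi)) has_real_derivative
      ((- 2 * a + 2 * b) / P 1 - (2 - 2 * a) / Q 1) / (4 * pi)) (at 1)"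
    by (intro DERIV_cdivide DERIV_diff)
  also have "((- 2 * a + 2 * b) / P 1 - (2 - 2 * a) / Q 1) / (4 * pi) = - (1 - b) / (2 * pi * Q 1)"
    using Q1 unfolding PQ by (simp add: divide_simps)
  finally have "((\<lambda>r. (ln (P r) - ln (Q r)) / (4 * pi)) has_vector_derivative - (1 - b) / (2 * pi * Q 1))
      (at 1 within {0..1})"
    by (simp add: has_real_derivative_iff_has_vector_derivative has_vector_derivative_at_within)
  then have "((\<lambda>r. G (of_real r * cis \<theta>) y) has_vector_derivative - (1 - b) / (2 * pi * Q 1))
      (at 1 within {0..1})"
  proof (rule has_vector_derivative_transform_within)
    \<comment> \<open>Within this distance of 1 the radius exceeds |y|, so the ray avoids the pole
      and the explicit formula applies.\<close>
    show "0 < 1 - cmod y" using y by simp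
    fix r :: real assume r: "r \<in> {0..1}" "dist r 1 < 1 - cmod y"
    have z: "of_real r * cis \<theta> \<in> cball 0 1 - {y}"
      using r by (auto simp: norm_mult dist_real_def)
    have "G (of_real r * cis \<theta>) y = disk_green (of_real r * cis \<theta>) y"
      by (rule dirichlet_green_eq_disk_green [OF G y z])
    also have "\<dots> = (ln (P r) - ln (Q r)) / (4 * pi)"
    proof -
      have "ln (P r) = 2 * ln (cmod (1 - cnj y * (of_real r * cis \<theta>)))"
        unfolding P [symmetric] using z one_minus_cnj_mult_neq_0 [OF y]
        by (subst ln_realpow) auto
      moreover have "ln (Q r) = 2 * ln (cmod (of_real r * cis \<theta> - y))"
        unfolding Q [symmetric] using z by (subst ln_realpow) auto
      ultimately show ?thesis
        by (simp add: disk_green_def diff_divide_distrib)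
    qed
    finally show "(ln (P r) - ln (Q r)) / (4 * pi) = G (of_real r * cis \<theta>) y" by simp
  qed auto
  then have "normal_derivative (\<lambda>x. G x y) \<theta> = - (1 - b) / (2 * pi * Q 1)"
    unfolding normal_derivative_def by (intro vector_derivative_within_closed_interval [of 0 1]) auto
  then show ?thesis
    using Q [of 1] by (simp add: b_def)
qed

section \<open>The moments\<close>

lemma poisson_kernel_moment:
  assumes y: "y \<in> ball 0 1"
  shows "((\<lambda>\<theta>. complex_of_real ((1 - (cmod y)\<^sup>2) / (cmod (cis \<theta> - y))\<^sup>2) *
    exp (- \<i> * of_nat n * of_real \<theta>)) has_integral 2 * pi * cnj y ^ n) {0..2 * pi}"
proof -
  \<comment> \<open>On the circle \<open>\<bar>z - y\<bar>\<^sup>2 = (z - y) (1 - y\<^sup>* z) / z\<close>, so the conjugate of the integral is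
    \<open>1 / \<i>\<close> times the contour integral of \<open>f z / (z - y)\<close>.\<close>
  define f where "f z = z ^ n * (1 - cnj y * y) / (1 - cnj y * z)" for z
  have neq: "1 - cnj y * y \<noteq> 0"
    using one_minus_cnj_mult_neq_0 [OF y, of y] y by auto
  have "f holomorphic_on cball 0 1"
    unfolding f_def using one_minus_cnj_mult_neq_0 [OF y] by (intro holomorphic_intros) auto
  then have "((\<lambda>u. f u / (u - y)) has_contour_integral 2 * of_real pi * \<i> * f y) (circlepath 0 1)"
    using y by (intro Cauchy_integral_circlepath_simple) auto
  then have "((\<lambda>t. f (cis t) / (cis t - y) * \<i> * cis t) has_integral 2 * of_real pi * \<i> * f y) {0..2 * pi}"
    using has_contour_integral_part_circlepath_iff
      [of 0 "2 * pi" "\<lambda>u. f u / (u - y)" "2 * of_real pi * \<i> * f y" 0 1]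
    by (simp add: circlepath_def)
  \<comment> \<open>The factor -i removes the i from dz = i z dt.\<close>
  then have "((\<lambda>t. - \<i> * (f (cis t) / (cis t - y) * \<i> * cis t)) has_integral
      - \<i> * (2 * of_real pi * \<i> * f y)) {0..2 * pi}"
    by (rule has_integral_mult_right)
  then have "((\<lambda>t. cnj (- \<i> * (f (cis t) / (cis t - y) * \<i> * cis t))) has_integral
      cnj (- \<i> * (2 * of_real pi * \<i> * f y))) {0..2 * pi}"
    by (rule has_integral_cnj [unfolded comp_def, THEN iffD2])
  moreover have "cnj (- \<i> * (2 * of_real pi * \<i> * f y)) = 2 * pi * cnj y ^ n"
  proof -
    \<comment> \<open>The constant factor in \<open>f\<close> is the numerator 1 - |y|^2 of the
      Poisson kernel; it cancels the denominator at \<open>y\<close>.\<close>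
    have "f y = y ^ n"
      unfolding f_def using neq by (rule nonzero_mult_div_cancel_right)
    moreover have "cnj (- \<i> * (2 * of_real pi * \<i> * w)) = 2 * pi * cnj w" for w
      by simp
    ultimately show ?thesis
      by (simp only: complex_cnj_power)
  qed
  moreover have "cnj (- \<i> * (f (cis t) / (cis t - y) * \<i> * cis t)) =
      complex_of_real ((1 - (cmod y)\<^sup>2) / (cmod (cis t - y))\<^sup>2) * exp (- \<i> * of_nat n * of_real t)" for t
  proof -
    have "1 - cnj y * cis t = cis t * cnj (cis t - y)"
      using complex_norm_square [of "cis t"] by (simp add: algebra_simps)
    then have f: "f (cis t) = cis t ^ n * (1 - cnj y * y) / (cis t * cnj (cis t - y))"
      by (simp only: f_def)
    have "- \<i> * (u * \<i> * w) = u * w" for u w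
      by (simp add: complex_eq_iff)
    then have "- \<i> * (f (cis t) / (cis t - y) * \<i> * cis t) = f (cis t) / (cis t - y) * cis t" .
    also have "\<dots> = cis t ^ n * (1 - cnj y * y) / ((cis t - y) * cnj (cis t - y))"
      unfolding f by (simp del: complex_cnj_diff)
    also have "\<dots> = cis t ^ n * complex_of_real ((1 - (cmod y)\<^sup>2) / (cmod (cis t - y))\<^sup>2)"
      unfolding of_real_divide of_real_diff complex_norm_square by (simp add: mult.commute)
    finally have *: "- \<i> * (f (cis t) / (cis t - y) * \<i> * cis t) = \<dots>" .
    have "cnj (cis t ^ n) = exp (- \<i> * of_nat n * of_real t)"
      by (subst Complex.DeMoivre) (simp add: cis_conv_exp exp_cnj mult_ac)
    then show ?thesis
      unfolding * by (simp add: mult.commute)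
  qed
  ultimately show ?thesis
    by (simp only:)
qed

text \<open>The factor 2 pi from the Poisson integral cancels the normalization of the moment; the
  remaining -1 / (2 pi) comes from the normal derivative. The nodes are conjugated because the
  moments use negative frequencies.\<close>

lemma ideal_moment_steady_flux:
  assumes G: "dirichlet_green 0 G" and p: "\<forall>j\<in>{1..N}. p j \<in> ball 0 1"
  shows "ideal_moment (steady_flux G N p q) n =
    (\<Sum>j=1..N. of_real (- (q j / (2 * pi))) * cnj (p j) ^ n)"
proof -
  have flux: "of_real (steady_flux G N p q \<theta>) * exp (- \<i> * of_nat n * of_real \<theta>) =
      (\<Sum>j=1..N. - (of_real (q j) / (2 * pi)) *
        (complex_of_real ((1 - (cmod (p j))\<^sup>2) / (cmod (cis \<theta> - p j))\<^sup>2) *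
          exp (- \<i> * of_nat n * of_real \<theta>)))" for \<theta>
  proof -
    have "steady_flux G N p q \<theta> = (\<Sum>j=1..N. - (q j / (2 * pi)) *
        ((1 - (cmod (p j))\<^sup>2) / (cmod (cis \<theta> - p j))\<^sup>2))"
      unfolding steady_flux_def using p
      by (intro sum.cong refl, subst normal_derivative_dirichlet_green [OF G])
         (auto simp: right_diff_distrib diff_divide_distrib)
    then show ?thesis
      by (simp add: sum_distrib_right mult.assoc)
  qed
  have "((\<lambda>\<theta>. of_real (steady_flux G N p q \<theta>) * exp (- \<i> * of_nat n * of_real \<theta>)) has_integral
      (\<Sum>j=1..N. - (of_real (q j) / (2 * pi)) * (2 * pi * cnj (p j) ^ n))) {0..2 * pi}"
    unfolding flux using p
    by (intro has_integral_sum has_integral_mult_right poisson_kernel_moment) auto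
  then have "integral {0..2 * pi} (\<lambda>\<theta>. of_real (steady_flux G N p q \<theta>) * exp (- \<i> * of_nat n * of_real \<theta>)) =
      (\<Sum>j=1..N. - (of_real (q j) / (2 * pi)) * (2 * pi * cnj (p j) ^ n))"
    by (rule integral_unique)
  then show ?thesis
    unfolding ideal_moment_def by (simp add: sum_distrib_left)
qed

section \<open>Numerical rank of the Hankel matrices\<close>

lemma hankel_carrier [simp]: "hankel m M \<in> carrier_mat m m"
  by (simp add: hankel_def)

lemma hankel_index [simp]: "r < m \<Longrightarrow> c < m \<Longrightarrow> hankel m M $$ (r, c) = M (r + c)"
  by (simp add: hankel_def)

text \<open>The power z^(r+c) splits as z^r z^c, so the matrix factors through the Vandermonde
  matrix \<open>F\<close>, whose rows evaluate the polynomial with coefficients \<open>x\<close> at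
  the nodes. \<open>Suc i\<close> matches rows counted from 0 with nodes counted from 1.\<close>

lemma singular_value_hankel_exponential_sum:
  assumes M: "\<And>n. M n = (\<Sum>j=1..N. w j * z j ^ n)" and N: "N < m"
  shows "singular_values (hankel m M) ! N = 0"
proof -
  define F where "F = mat N m (\<lambda>(i, c). z (Suc i) ^ c)"
  have F: "F \<in> carrier_mat N m"
    by (simp add: F_def)
  show ?thesis
  proof (rule singular_value_zero_of_kernel [OF hankel_carrier F N])
    fix x assume x: "x \<in> carrier_vec m" and Fx: "F *\<^sub>v x = 0\<^sub>v N"
    have ker: "(\<Sum>c<m. z j ^ c * x $ c) = 0" if "j \<in> {1..N}" for j
    proof -
      have "(\<Sum>c<m. z j ^ c * x $ c) = (F *\<^sub>v x) $ (j - 1)"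
        using that x by (auto simp: F_def scalar_prod_def lessThan_atLeast0)
      also have "\<dots> = 0"
        unfolding Fx using that by auto
      finally show ?thesis .
    qed
    show "hankel m M *\<^sub>v x = 0\<^sub>v m"
    proof (rule eq_vecI)
      fix r assume "r < dim_vec (0\<^sub>v m :: complex vec)"
      then have r: "r < m" by simp
      have "(hankel m M *\<^sub>v x) $ r = (\<Sum>c<m. M (r + c) * x $ c)"
        using r x by (auto simp: hankel_def scalar_prod_def lessThan_atLeast0)
      also have "\<dots> = (\<Sum>c<m. \<Sum>j=1..N. w j * z j ^ r * (z j ^ c * x $ c))"
        by (simp add: M sum_distrib_right power_add mult.assoc)
      also have "\<dots> = (\<Sum>j=1..N. \<Sum>c<m. w j * z j ^ r * (z j ^ c * x $ c))"
        by (rule sum.swap)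
      also have "\<dots> = (\<Sum>j=1..N. w j * z j ^ r * (\<Sum>c<m. z j ^ c * x $ c))"
        by (simp only: sum_distrib_left)
      also have "\<dots> = 0"
        using ker by (intro sum.neutral) auto
      finally show "(hankel m M *\<^sub>v x) $ r = 0\<^sub>v m $ r"
        using r by simp
    qed (simp add: hankel_def)
  qed
qed

theorem theorem3p2:
  fixes G :: "complex \<Rightarrow> complex \<Rightarrow> real"
    and N m L :: nat
    and p :: "nat \<Rightarrow> complex" and q :: "nat \<Rightarrow> real" and \<eta> :: "nat \<Rightarrow> real"
    and \<epsilon> \<tau> :: real
  defines "g \<equiv> steady_flux G N p q"
  defines "M \<equiv> ideal_moment g"
    and "M' \<equiv> noisy_moment g L \<eta>"
  defines "H \<equiv> hankel m M"
    and "H' \<equiv> hankel m M'"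
  assumes "dirichlet_green 0 G"
    and "N \<ge> 1" and "L \<ge> 1" and "m \<ge> N"
    and "\<forall>j\<in>{1..N}. p j \<in> ball 0 1"
    and "inj_on p {1..N}"
    and "\<forall>j\<in>{1..N}. q j \<noteq> 0"
    and "(MAX n\<in>{0..2*m-2}. cmod (M' n - M n)) \<le> \<epsilon>"
    and "real m * \<epsilon> < 1/2 * singular_value H N"
    and "real m * \<epsilon> < \<tau>"
    and "\<tau> < singular_value H N - real m * \<epsilon>"
  shows "card {k\<in>{1..m}. singular_value H' k > \<tau>} = N"
proof -
  have bound: "cmod (M' n - M n) \<le> \<epsilon>" if "n \<le> 2 * m - 2" for n
  proof -
    have "cmod (M' n - M n) \<le> (MAX n\<in>{0..2*m-2}. cmod (M' n - M n))"
      using that by (intro Max_ge) auto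
    then show ?thesis
      using assms(13) by (rule order_trans)
  qed
  have diff: "cmod (H' $$ (i, j) - H $$ (i, j)) \<le> \<epsilon>" if "i < m" "j < m" for i j
    using that bound [of "i + j"] by (simp add: H_def H'_def)
  have diff': "cmod (H $$ (i, j) - H' $$ (i, j)) \<le> \<epsilon>" if "i < m" "j < m" for i j
    using diff [OF that] by (simp add: norm_minus_commute)
  have carr: "H \<in> carrier_mat m m" "H' \<in> carrier_mat m m"
    by (simp_all add: H_def H'_def)
  have len: "length (singular_values H') = m"
    using length_singular_values [OF carr(2)] .
  \<comment> \<open>The upper threshold condition: sigma_N drops by at most
    \<open>m * \<epsilon>\<close> in passing from \<open>H\<close> to \<open>H'\<close>.\<close>
  have top: "\<tau> < singular_values H' ! (N - 1)"
  proof -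
    have "N - 1 < m"
      using \<open>N \<ge> 1\<close> \<open>m \<ge> N\<close> by simp
    from singular_value_perturbation [OF carr this diff'] show ?thesis
      using assms(16) by (simp add: singular_value_def)
  qed
  \<comment> \<open>The lower threshold condition: sigma_(N+1) rises from 0 by at most
    \<open>m * \<epsilon>\<close>. For \<open>N = m\<close> there is no such singular value, hence
    the guard.\<close>
  have bottom: "singular_values H' ! N < \<tau>" if "N < m"
  proof -
    have "singular_values H ! N = 0"
      unfolding H_def M_def g_def
      using ideal_moment_steady_flux [OF assms(6,10)] that
      by (rule singular_value_hankel_exponential_sum)
    then show ?thesis
      using singular_value_perturbation [OF carr(2,1) that diff] assms(15) by simp
  qed
  have "{k\<in>{1..m}. singular_value H' k > \<tau>} = {1..N}"
  proof (intro equalityI subsetI)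
    fix k assume k: "k \<in> {k\<in>{1..m}. singular_value H' k > \<tau>}"
    show "k \<in> {1..N}"
    proof (rule ccontr)
      assume "k \<notin> {1..N}"
      \<comment> \<open>An index beyond \<open>N\<close> but within \<open>m\<close> itself supplies
        the \<open>N < m\<close> that \<open>bottom\<close> asks for.\<close>
      with k have "N \<le> k - 1" "k - 1 < m" by auto
      then have "singular_values H' ! (k - 1) \<le> singular_values H' ! N"
        by (intro singular_values_antimono) (simp_all add: len)
      with k bottom \<open>N \<le> k - 1\<close> \<open>k - 1 < m\<close> show False
        by (simp add: singular_value_def)
    qed
  next
    fix k assume k: "k \<in> {1..N}"
    then have "singular_values H' ! (N - 1) \<le> singular_values H' ! (k - 1)"
      using \<open>m \<ge> N\<close> by (intro singular_values_antimono) (auto simp: len)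
    with k top \<open>m \<ge> N\<close> show "k \<in> {k\<in>{1..m}. singular_value H' k > \<tau>}"
      by (simp add: singular_value_def)
  qed
  then show ?thesis by simp
qed

end
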